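(* Let $\Xi$ be the solution of the discrete-time Lyapunov equation $$\Xi=\hat F\,\Xi\,\hat F^*+\hat G\hat G^* ,$$ where $$\hat F:=\begin{bmatrix}F&0\\ B(B^*PB)^{-1/2}H&Z\end{bmatrix},\qquad \hat G:=\begin{bmatrix}G_\Psi\\ B(B^*PB)^{-1/2}D\end{bmatrix}.$$ Then the integral $\int G\frac{\Psi}{G^*\Lambda G}G^*$ is the bottom-right $n\times n$ block of $\Xi$, i.e. $$\int G\frac{\Psi}{G^*\Lambda G}G^*=[\,0\mid I\,]\;\Xi\begin{bmatrix}0\\ I\end{bmatrix}.$$
   Context: Notation. $\mathbb T$ is the unit circle in $\mathbb C$; $\mathfrak H_n$ is the space of $n\times n$ Hermitian matrices; $C_+(\mathbb T)$ is the set of continuous, real-valued, strictly positive functions on $\mathbb T$. For a (matrix-valued) function $f$ on $\mathbb T$, $\int f:=\frac{1}{2\pi}\int_{-\pi}^{\pi}f(e^{j\vartheta})\,d\vartheta$. The superscript $*$ is the conjugate transpose (on $\mathbb T$, for functions). Standing assumptions. $A\in\mathbb C^{n\times n}$ has all its eigenvalues in the open unit disc and at least one eigenvalue equal to $0$; $B\in\mathbb C^{n\times 1}$; the pair $(A,B)$ is reachable; $G(z)=(zI-A)^{-1}B$. $\Psi\in C_+(\mathbb T)$ with $\int\Psi=1$. There exists $\Phi\in C_+(\mathbb T)$ with $\int G\Phi G^*=I$, and (normalization) every such $\Phi$ satisfies $\int\Phi=1$. Setting of the statement. $\Psi$ is in addition rational, and $W_\Psi(z)=H(zI-F)^{-1}G_\Psi+D$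 is a minimal realization of a minimal minimum-phase (scalar) spectral factor of $\Psi$, i.e. $\Psi=W_\Psi W_\Psi^*$ on $\mathbb T$ with $F$ having all its eigenvalues in the open unit disc. $\Lambda\in\mathfrak H_n$ is such that $G^*\Lambda G>0$ on $\mathbb T$. $P\in\mathfrak H_n$ is the stabilizing solution of the algebraic Riccati equation $$\Pi=A^*\Pi A-A^*\Pi B(B^*\Pi B)^{-1}B^*\Pi A+\Lambda ,$$ that is, the Hermitian solution (it satisfies $B^*PB>0$) for which $$Z:=A-B(B^*PB)^{-1}B^*PA$$ has all its eigenvalues in the open unit disc. In $[0\mid I]$, $I$ is $n\times n$ and $0$ is the zero matrix with as many columns as $F$. *)

theory Defs
  imports
    "HOL-Analysis.Analysis"
    "HOL-Computational_Algebra.Polynomial"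
    "Jordan_Normal_Form.Schur_Decomposition"
    "Jordan_Normal_Form.Gauss_Jordan_Elimination"
    "Jordan_Normal_Form.DL_Rank"
begin

text \<open>Matrix dimensions are natural numbers and may be \<open>0\<close>: a constant spectral factor has a
  state space of dimension \<open>0\<close>. Scalars such as \<open>B\<^sup>*PB\<close> are 1-by-1 matrices. For complex \<open>z\<close>,
  \<open>0 < z\<close> means that \<open>z\<close> is real and positive.\<close>

abbreviation unit_circle :: "complex set" where
  "unit_circle \<equiv> sphere 0 1"

definition matinv :: "complex mat \<Rightarrow> complex mat" where
  "matinv M = the (mat_inverse M)"

definition hermitian_mats :: "nat \<Rightarrow> complex mat set" where
  "hermitian_mats n = {X \<in> carrier_mat n n. mat_adjoint X = X}"

definition stable_mat :: "complex mat \<Rightarrow> bool" where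
  "stable_mat M \<longleftrightarrow> (\<forall>z. eigenvalue M z \<longrightarrow> cmod z < 1)"

definition append_cols :: "complex mat \<Rightarrow> complex mat \<Rightarrow> complex mat" where
  "append_cols X Y = four_block_mat X Y (0\<^sub>m 0 (dim_col X)) (0\<^sub>m 0 (dim_col Y))"

definition inv_sqrt :: "complex mat \<Rightarrow> complex mat" where
  \<comment> \<open>\<open>M\<^sup>-\<^sup>1\<^sup>/\<^sup>2\<close> for a positive 1-by-1 matrix \<open>M\<close>\<close>
  "inv_sqrt M = mat 1 1 (\<lambda>_. complex_of_real (1 / sqrt (Re (M $$ (0, 0)))))"

definition C_plus :: "(complex \<Rightarrow> real) set" where
  "C_plus = {f. continuous_on unit_circle f \<and> (\<forall>z\<in>unit_circle. 0 < f z)}"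

definition circle_mean :: "(complex \<Rightarrow> 'a::real_normed_vector) \<Rightarrow> 'a" where
  "circle_mean f = (1 / (2 * pi)) *\<^sub>R integral {-pi..pi} (\<lambda>\<theta>. f (cis \<theta>))"

definition circle_mean_mat :: "nat \<Rightarrow> (complex \<Rightarrow> complex mat) \<Rightarrow> complex mat" where
  "circle_mean_mat n M = mat n n (\<lambda>(i, j). circle_mean (\<lambda>z. M z $$ (i, j)))"

definition rational_on_circle :: "(complex \<Rightarrow> real) \<Rightarrow> bool" where
  "rational_on_circle f \<longleftrightarrow> (\<exists>p q :: complex poly. \<forall>z\<in>unit_circle.
     poly q z \<noteq> 0 \<and> complex_of_real (f z) = poly p z / poly q z)"

definition reachable :: "nat \<Rightarrow> complex mat \<Rightarrow> complex mat \<Rightarrow> bool" where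
  \<comment> \<open>single input: \<open>B\<close> is n-by-1, and the matrix below is \<open>[B, AB, \<dots>, A\<^sup>n\<^sup>-\<^sup>1B]\<close>\<close>
  "reachable n A B \<longleftrightarrow> vec_space.rank n (mat n n (\<lambda>(i, j). ((A ^\<^sub>m j) * B) $$ (i, 0))) = n"

definition input_to_state :: "complex mat \<Rightarrow> complex mat \<Rightarrow> complex \<Rightarrow> complex mat" where
  "input_to_state A B z = matinv (z \<cdot>\<^sub>m 1\<^sub>m (dim_row A) - A) * B"

text \<open>Scalar rational functions are given by realizations; the values of \<open>transfer\<close> at
  eigenvalues of the state matrix are meaningless and are excluded wherever they could matter.\<close>

definition state_space ::
  "nat \<Rightarrow> complex mat \<Rightarrow> complex mat \<Rightarrow> complex mat \<Rightarrow> complex mat \<Rightarrow> bool" where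
  "state_space m F G H D \<longleftrightarrow>
     F \<in> carrier_mat m m \<and> G \<in> carrier_mat m 1 \<and> H \<in> carrier_mat 1 m \<and> D \<in> carrier_mat 1 1"

definition transfer ::
  "complex mat \<Rightarrow> complex mat \<Rightarrow> complex mat \<Rightarrow> complex mat \<Rightarrow> complex \<Rightarrow> complex" where
  "transfer F G H D z = (H * matinv (z \<cdot>\<^sub>m 1\<^sub>m (dim_row F) - F) * G + D) $$ (0, 0)"

definition minimal_realization ::
  "nat \<Rightarrow> complex mat \<Rightarrow> complex mat \<Rightarrow> complex mat \<Rightarrow> complex mat \<Rightarrow> bool" where
  "minimal_realization m F G H D \<longleftrightarrow> state_space m F G H D \<and>
     (\<forall>m' F' G' H' D'. state_space m' F' G' H' D' \<and>
        (\<forall>z. \<not> eigenvalue F z \<and> \<not> eigenvalue F' z \<longrightarrow>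
           transfer F' G' H' D' z = transfer F G H D z) \<longrightarrow> m \<le> m')"

definition spectral_factor :: "(complex \<Rightarrow> real) \<Rightarrow>
    complex mat \<Rightarrow> complex mat \<Rightarrow> complex mat \<Rightarrow> complex mat \<Rightarrow> bool" where
  "spectral_factor \<Psi> F G H D \<longleftrightarrow> (\<forall>z\<in>unit_circle. \<not> eigenvalue F z \<longrightarrow>
     complex_of_real (\<Psi> z) = transfer F G H D z * cnj (transfer F G H D z))"

text \<open>A spectral factor is minimal if no spectral factor has smaller McMillan degree, i.e. smaller
  least dimension of a realization. The definition below is applied to a minimal realization, whose
  dimension \<open>m\<close> is the McMillan degree.\<close>

definition minimal_spectral_factor :: "(complex \<Rightarrow> real) \<Rightarrow>
    nat \<Rightarrow> complex mat \<Rightarrow> complex mat \<Rightarrow> complex mat \<Rightarrow> complex mat \<Rightarrow> bool" where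
  "minimal_spectral_factor \<Psi> m F G H D \<longleftrightarrow> spectral_factor \<Psi> F G H D \<and>
     (\<forall>m' F' G' H' D'. state_space m' F' G' H' D' \<and> spectral_factor \<Psi> F' G' H' D' \<longrightarrow> m \<le> m')"

text \<open>Minimum phase: neither poles nor zeros in \<open>{z. 1 \<le> cmod z}\<close>, nor a zero at infinity, where
  the value of the transfer function is \<open>D\<close>.\<close>

definition minimum_phase ::
  "complex mat \<Rightarrow> complex mat \<Rightarrow> complex mat \<Rightarrow> complex mat \<Rightarrow> bool" where
  "minimum_phase F G H D \<longleftrightarrow> stable_mat F \<and>
     (\<forall>z. 1 \<le> cmod z \<longrightarrow> transfer F G H D z \<noteq> 0) \<and> D $$ (0, 0) \<noteq> 0"

definition closed_loop :: "complex mat \<Rightarrow> complex mat \<Rightarrow> complex mat \<Rightarrow> complex mat" where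
  "closed_loop A B P =
     A - B * matinv (mat_adjoint B * P * B) * mat_adjoint B * P * A"

definition riccati_equation ::
  "complex mat \<Rightarrow> complex mat \<Rightarrow> complex mat \<Rightarrow> complex mat \<Rightarrow> bool" where
  "riccati_equation A B \<Lambda> X \<longleftrightarrow>
     X = mat_adjoint A * X * A
       - mat_adjoint A * X * B * matinv (mat_adjoint B * X * B) * mat_adjoint B * X * A + \<Lambda>"

definition stabilizing_solution ::
  "nat \<Rightarrow> complex mat \<Rightarrow> complex mat \<Rightarrow> complex mat \<Rightarrow> complex mat \<Rightarrow> bool" where
  "stabilizing_solution n A B \<Lambda> P \<longleftrightarrow>
     P \<in> hermitian_mats n \<and> riccati_equation A B \<Lambda> P \<and>
     0 < (mat_adjoint B * P * B) $$ (0, 0) \<and> stable_mat (closed_loop A B P)"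

end

theory Submission
  imports Defs "Jordan_Normal_Form.Spectral_Radius"
begin

text \<open>
  Write \<open>R(z)\<close> for the resolvent \<open>(zI - F\<^sub>h)\<^sup>-\<^sup>1\<close>. On the unit circle the
  integrand \<open>(\<Psi> / G\<^sup>*\<Lambda>G) GG\<^sup>*\<close> is \<open>(wG)(wG)\<^sup>*\<close> for the scalar quotient
  \<open>w = W\<^sub>\<Psi> / W\<^sub>\<Lambda>\<close> of spectral factors of \<open>\<Psi>\<close> and \<open>G\<^sup>*\<Lambda>G\<close>, and \<open>wG\<close> is the
  lower part of the state response \<open>R(z)G\<^sub>h\<close> of a cascade of two stable systems. The mean of
  \<open>R G\<^sub>hG\<^sub>h\<^sup>* R\<^sup>*\<close> is the controllability Gramian, that is \<open>\<Xi>\<close>.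

  The factor of \<open>G\<^sup>*\<Lambda>G\<close> comes from the Riccati equation (\<open>riccati_factorization\<close>): with
  \<open>b = B\<^sup>*PB\<close> and \<open>v = B\<^sup>*PAG\<close>, one has \<open>G\<^sup>*\<Lambda>G = |b + v|\<^sup>2 / b\<close>, so
  \<open>W\<^sub>\<Lambda> = b\<^sup>-\<^sup>1\<^sup>/\<^sup>2 (b + v)\<close>. Feeding \<open>v\<close> back turns \<open>A\<close> into \<open>Z\<close>
  (\<open>closed_loop_shift\<close>), which gives \<open>(zI - Z) G = (1 + v/b) B\<close> and hence
  \<open>G / W\<^sub>\<Lambda> = (zI - Z)\<^sup>-\<^sup>1 B b\<^sup>-\<^sup>1\<^sup>/\<^sup>2\<close>. Driving this system by the output of the realization of
  \<open>W\<^sub>\<Psi>\<close> gives the cascade \<open>(F\<^sub>h, G\<^sub>h)\<close> (\<open>cascade_state\<close>).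

  The mean of \<open>RQR\<^sup>*\<close> is found algebraically (\<open>circle_mean_gramian_eq\<close>). Since \<open>|z| = 1\<close>, one may replace \<open>R\<close> by \<open>zR = F\<^sub>hR + I\<close> in \<open>RQR\<^sup>*\<close>; taking means yields the
  Lyapunov equation for the mean of \<open>RQR\<^sup>*\<close>, because the cross terms contain the mean of \<open>R\<close>, which
  is zero (\<open>circle_mean_resolvent\<close>). That mean vanishes, and the Lyapunov equation has only one
  solution, for the same reason: the powers of a stable matrix tend to zero.
\<close>

section \<open>Matrices and adjoints\<close>

lemma dim_adjoint [simp]:
  "dim_row (mat_adjoint X) = dim_col X" "dim_col (mat_adjoint X) = dim_row X"
  by (auto simp: mat_adjoint_def)

lemma index_adjoint [simp]:
  "i < dim_col X \<Longrightarrow> j < dim_row X \<Longrightarrow> mat_adjoint X $$ (i, j) = conjugate (X $$ (j, i))"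
  by (auto simp: mat_adjoint_def mat_of_rows_def)

lemma adjoint_carrier [simp]:
  "X \<in> carrier_mat r c \<Longrightarrow> mat_adjoint X \<in> carrier_mat c r"
  by (auto intro: carrier_matI)

lemma adjoint_adjoint [simp]: "mat_adjoint (mat_adjoint X) = X"
  by (rule eq_matI) auto

lemma adjoint_one [simp]: "mat_adjoint (1\<^sub>m k :: complex mat) = 1\<^sub>m k"
  by (rule eq_matI) auto

lemma adjoint_add:
  "dim_row X = dim_row Y \<Longrightarrow> dim_col X = dim_col Y \<Longrightarrow>
   mat_adjoint (X + Y) = mat_adjoint X + mat_adjoint Y"
  by (rule eq_matI) (auto simp: conjugate_dist_add)

lemma adjoint_smult: "mat_adjoint (a \<cdot>\<^sub>m X) = conjugate a \<cdot>\<^sub>m mat_adjoint X"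
  by (rule eq_matI) (auto simp: conjugate_dist_mul)

lemma adjoint_mult:
  fixes X Y :: "complex mat"
  shows "dim_col X = dim_row Y \<Longrightarrow> mat_adjoint (X * Y) = mat_adjoint Y * mat_adjoint X"
  by (rule eq_matI) (auto simp: scalar_prod_def mult.commute)

text \<open>Carrier hypotheses mention dimensions that do not occur in the terms to be
  rewritten, so the simplifier has to guess them. Stated with equations between dimensions, the
  laws become conditional rewrite rules.\<close>

lemma mult_assoc_dim:
  fixes X Y W :: "'a::semiring_0 mat"
  shows "dim_col X = dim_row Y \<Longrightarrow> dim_col Y = dim_row W \<Longrightarrow> (X * Y) * W = X * (Y * W)"
  by (rule assoc_mult_mat) (auto intro: carrier_matI)

lemma distrib_right_dim:
  fixes X Y W :: "'a::semiring_0 mat"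
  shows "dim_row X = dim_row Y \<Longrightarrow> dim_col X = dim_col Y \<Longrightarrow> dim_col Y = dim_row W \<Longrightarrow>
    (X + Y) * W = X * W + Y * W"
  by (rule add_mult_distrib_mat) (auto intro: carrier_matI)

lemma distrib_left_dim:
  fixes X Y W :: "'a::semiring_0 mat"
  shows "dim_col W = dim_row X \<Longrightarrow> dim_row X = dim_row Y \<Longrightarrow> dim_col X = dim_col Y \<Longrightarrow>
    W * (X + Y) = W * X + W * Y"
  by (rule mult_add_distrib_mat) (auto intro: carrier_matI)

lemma minus_distrib_right_dim:
  fixes X Y W :: "'a::ring mat"
  shows "dim_row X = dim_row Y \<Longrightarrow> dim_col X = dim_col Y \<Longrightarrow> dim_col Y = dim_row W \<Longrightarrow>
    (X - Y) * W = X * W - Y * W"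
  by (rule minus_mult_distrib_mat) (auto intro: carrier_matI)

lemma minus_distrib_left_dim:
  fixes X Y W :: "'a::ring mat"
  shows "dim_col W = dim_row X \<Longrightarrow> dim_row X = dim_row Y \<Longrightarrow> dim_col X = dim_col Y \<Longrightarrow>
    W * (X - Y) = W * X - W * Y"
  by (rule mult_minus_distrib_mat) (auto intro: carrier_matI)

lemma smult_left_dim:
  fixes X Y :: "'a::comm_semiring_0 mat"
  shows "dim_col X = dim_row Y \<Longrightarrow> (a \<cdot>\<^sub>m X) * Y = a \<cdot>\<^sub>m (X * Y)"
  by (rule mult_smult_assoc_mat) (auto intro: carrier_matI)

lemma smult_right_dim:
  fixes X Y :: "'a::comm_semiring_0 mat"
  shows "dim_col X = dim_row Y \<Longrightarrow> X * (a \<cdot>\<^sub>m Y) = a \<cdot>\<^sub>m (X * Y)"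
  by (rule mult_smult_distrib) (auto intro: carrier_matI)

lemma one_mult_dim [simp]: 
  fixes X :: "'a::semiring_1 mat"
  shows "dim_row X = k \<Longrightarrow> 1\<^sub>m k * X = X" "dim_col X = k \<Longrightarrow> X * 1\<^sub>m k = X"
  by (auto intro!: left_mult_one_mat right_mult_one_mat carrier_matI)

lemmas mat_expand = mult_assoc_dim distrib_right_dim distrib_left_dim
  minus_distrib_right_dim minus_distrib_left_dim smult_left_dim smult_right_dim

text \<open>This turns the 1-by-1 matrices of a single-input system into scalars.\<close>

lemma scalar_mat_mult:
  fixes X M :: "'a::comm_semiring_0 mat"
  assumes "dim_col X = 1" "M \<in> carrier_mat 1 1"
  shows "X * M = M $$ (0, 0) \<cdot>\<^sub>m X"
  using assms by (intro eq_matI) (auto simp: scalar_prod_def mult.commute)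

lemma smult_smult_mat: "a \<cdot>\<^sub>m (b \<cdot>\<^sub>m X) = (a * b) \<cdot>\<^sub>m (X :: 'a::semigroup_mult mat)"
  by (rule eq_matI) (auto simp: mult.assoc)

lemma one_smult_mat: "1 \<cdot>\<^sub>m X = (X :: 'a::monoid_mult mat)"
  by (rule eq_matI) auto

lemma index_mult_sum:
  assumes "X \<in> carrier_mat r k" "Y \<in> carrier_mat k c" "i < r" "j < c"
  shows "(X * Y) $$ (i, j) = (\<Sum>a<k. X $$ (i, a) * Y $$ (a, j))"
  using assms by (simp add: scalar_prod_def atLeast0LessThan)

lemma mult_append_rows:
  fixes F11 F21 F22 X Y :: "complex mat"
  assumes "F11 \<in> carrier_mat m m" "F21 \<in> carrier_mat n m" "F22 \<in> carrier_mat n n"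
    "X \<in> carrier_mat m c" "Y \<in> carrier_mat n c"
  shows "four_block_mat F11 (0\<^sub>m m n) F21 F22 * (X @\<^sub>r Y) = (F11 * X) @\<^sub>r (F21 * X + F22 * Y)"
proof -
  have "four_block_mat F11 (0\<^sub>m m n) F21 F22 * four_block_mat X (0\<^sub>m m 0) Y (0\<^sub>m n 0)
      = four_block_mat (F11 * X + 0\<^sub>m m n * Y) (F11 * 0\<^sub>m m 0 + 0\<^sub>m m n * 0\<^sub>m n 0)
          (F21 * X + F22 * Y) (F21 * 0\<^sub>m m 0 + F22 * 0\<^sub>m n 0)"
    using assms by (intro mult_four_block_mat) auto
  thus ?thesis
    using assms by (simp add: append_rows_def)
qed

lemma index_append_rows:
  assumes "X \<in> carrier_mat r c" "Y \<in> carrier_mat s c" "i < r + s" "j < c"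
  shows "(X @\<^sub>r Y) $$ (i, j) = (if i < r then X $$ (i, j) else Y $$ (i - r, j))"
  using assms by (simp add: append_rows_def)

lemma bottom_right_block:
  assumes "X \<in> carrier_mat (m + n) (m + n)" "i < n" "j < n"
  shows "(append_cols (0\<^sub>m n m) (1\<^sub>m n) * X * (0\<^sub>m m n @\<^sub>r 1\<^sub>m n)) $$ (i, j) = X $$ (m + i, m + j)"
proof -
  let ?L = "append_cols (0\<^sub>m n m) (1\<^sub>m n) :: complex mat"
  let ?R = "0\<^sub>m m n @\<^sub>r 1\<^sub>m n :: complex mat"
  have L: "?L \<in> carrier_mat n (m + n)" and R: "?R \<in> carrier_mat (m + n) n"
    by (auto simp: append_cols_def)
  have Li: "?L $$ (i, a) = (if a = m + i then 1 else 0)" if "a < m + n" for a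
    using that assms by (auto simp: append_cols_def)
  have Rj: "?R $$ (a, j) = (if a = m + j then 1 else 0)" if "a < m + n" for a
    using that assms by (auto simp: append_rows_def)
  have LX: "(?L * X) $$ (i, a) = X $$ (m + i, a)" if "a < m + n" for a
  proof -
    have "(?L * X) $$ (i, a) = (\<Sum>b<m + n. (if b = m + i then 1 else 0) * X $$ (b, a))"
      using index_mult_sum[OF L assms(1,2) that] Li by simp
    also have "\<dots> = (\<Sum>b<m + n. if b = m + i then X $$ (b, a) else 0)"
      by (intro sum.cong) auto
    finally show ?thesis using assms by simp
  qed
  have "(?L * X * ?R) $$ (i, j) = (\<Sum>a<m + n. X $$ (m + i, a) * (if a = m + j then 1 else 0))"
    using index_mult_sum[OF mult_carrier_mat[OF L assms(1)] R assms(2,3)] LX Rj by simp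
  also have "\<dots> = (\<Sum>a<m + n. if a = m + j then X $$ (m + i, a) else 0)"
    by (intro sum.cong) auto
  finally show ?thesis using assms by simp
qed

section \<open>Inverses\<close>

lemma matinv_inverse:
  assumes "X \<in> carrier_mat k k" "det X \<noteq> 0"
  shows "matinv X \<in> carrier_mat k k" "X * matinv X = 1\<^sub>m k" "matinv X * X = 1\<^sub>m k"
proof -
  have "X \<in> Units (ring_mat TYPE(complex) k ())"
    using det_non_zero_imp_unit[OF assms] .
  with mat_inverse(1)[OF assms(1), where b = "()"] obtain Y where "mat_inverse X = Some Y"
    by (cases "mat_inverse X") auto
  with mat_inverse(2)[OF assms(1)] show "matinv X \<in> carrier_mat k k"
      "X * matinv X = 1\<^sub>m k" "matinv X * X = 1\<^sub>m k"
    by (auto simp: matinv_def)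
qed

text \<open>Cramer's rule, from which the continuity of the resolvent follows.\<close>

lemma matinv_adj_mat:
  assumes "X \<in> carrier_mat k k" "det X \<noteq> 0"
  shows "matinv X = inverse (det X) \<cdot>\<^sub>m adj_mat X"
proof -
  note inv = matinv_inverse[OF assms] and adj = adj_mat[OF assms(1)]
  have "det X \<cdot>\<^sub>m matinv X = adj_mat X * X * matinv X"
    using inv(1) assms adj by (simp add: smult_left_dim)
  also have "\<dots> = adj_mat X"
    using inv assms(1) adj(1) by (simp add: mult_assoc_dim)
  finally have "adj_mat X = det X \<cdot>\<^sub>m matinv X" ..
  thus ?thesis
    using assms(2) inv(1) by (intro eq_matI) auto
qed

lemma matinv_scalar:
  assumes "b \<noteq> 0"
  shows "matinv (b \<cdot>\<^sub>m 1\<^sub>m 1) = inverse b \<cdot>\<^sub>m 1\<^sub>m 1"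
proof -
  have "det (b \<cdot>\<^sub>m 1\<^sub>m 1) \<noteq> 0" using assms by simp
  from matinv_inverse[OF _ this]
  have inv: "matinv (b \<cdot>\<^sub>m 1\<^sub>m 1) \<in> carrier_mat 1 1" "b \<cdot>\<^sub>m 1\<^sub>m 1 * matinv (b \<cdot>\<^sub>m 1\<^sub>m 1) = 1\<^sub>m 1"
    by auto
  have "inverse b \<cdot>\<^sub>m (b \<cdot>\<^sub>m matinv (b \<cdot>\<^sub>m 1\<^sub>m 1)) = inverse b \<cdot>\<^sub>m 1\<^sub>m 1"
    using inv by (simp add: smult_left_dim)
  thus ?thesis using assms by (simp add: smult_smult_mat one_smult_mat)
qed

section \<open>Resolvents\<close>

definition resolvent :: "complex mat \<Rightarrow> complex \<Rightarrow> complex mat" where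
  "resolvent F z = matinv (z \<cdot>\<^sub>m 1\<^sub>m (dim_row F) - F)"

lemma det_pencil_nonzero:
  fixes F :: "complex mat"
  assumes "F \<in> carrier_mat k k" "\<not> eigenvalue F z"
  shows "det (z \<cdot>\<^sub>m 1\<^sub>m k - F) \<noteq> 0"
proof -
  have "z \<cdot>\<^sub>m 1\<^sub>m k - F = - char_matrix F z"
    using assms(1) by (intro eq_matI) (auto simp: char_matrix_def)
  thus ?thesis
    using assms eigenvalue_det[OF assms(1), of z] det_0_negate[of "char_matrix F z" k]
    by (simp add: char_matrix_def)
qed

lemma resolvent_inverse:
  assumes "F \<in> carrier_mat k k" "\<not> eigenvalue F z"
  shows "resolvent F z \<in> carrier_mat k k"
    "(z \<cdot>\<^sub>m 1\<^sub>m k - F) * resolvent F z = 1\<^sub>m k"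
    "resolvent F z * (z \<cdot>\<^sub>m 1\<^sub>m k - F) = 1\<^sub>m k"
proof -
  have "z \<cdot>\<^sub>m 1\<^sub>m k - F \<in> carrier_mat k k" "dim_row F = k"
    using assms by auto
  thus "resolvent F z \<in> carrier_mat k k"
    "(z \<cdot>\<^sub>m 1\<^sub>m k - F) * resolvent F z = 1\<^sub>m k"
    "resolvent F z * (z \<cdot>\<^sub>m 1\<^sub>m k - F) = 1\<^sub>m k"
    using matinv_inverse[OF _ det_pencil_nonzero[OF assms]] by (simp_all add: resolvent_def)
qed

lemma resolvent_equation:
  assumes F: "F \<in> carrier_mat k k" and ev: "\<not> eigenvalue F z"
  shows "z \<cdot>\<^sub>m resolvent F z = F * resolvent F z + 1\<^sub>m k"
proof -
  note R = resolvent_inverse[OF assms]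
  have "z \<cdot>\<^sub>m resolvent F z - F * resolvent F z = 1\<^sub>m k"
    using F R by (simp add: minus_distrib_right_dim smult_left_dim)
  hence diff: "(z \<cdot>\<^sub>m resolvent F z - F * resolvent F z) $$ (i, j) = 1\<^sub>m k $$ (i, j)" for i j
    by simp
  show ?thesis
  proof (rule eq_matI)
    fix i j assume "i < dim_row (F * resolvent F z + 1\<^sub>m k)" "j < dim_col (F * resolvent F z + 1\<^sub>m k)"
    thus "(z \<cdot>\<^sub>m resolvent F z) $$ (i, j) = (F * resolvent F z + 1\<^sub>m k) $$ (i, j)"
      using diff[of i j] F R(1) by (simp add: algebra_simps del: index_mult_mat(1) index_one_mat(1))
  qed (use F R(1) in auto)
qed

text \<open>Identifies the response of the cascade from its state equation.\<close>

lemma resolvent_unique: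
  assumes F: "F \<in> carrier_mat k k" and ev: "\<not> eigenvalue F z"
    and X: "X \<in> carrier_mat k c" and Y: "Y \<in> carrier_mat k c"
    and eq: "z \<cdot>\<^sub>m X = F * X + Y"
  shows "X = resolvent F z * Y"
proof -
  note R = resolvent_inverse[OF F ev]
  have "Y = (z \<cdot>\<^sub>m 1\<^sub>m k - F) * X"
  proof (rule eq_matI)
    fix i j assume "i < dim_row ((z \<cdot>\<^sub>m 1\<^sub>m k - F) * X)" "j < dim_col ((z \<cdot>\<^sub>m 1\<^sub>m k - F) * X)"
    hence ij: "i < k" "j < c" using F X by auto
    have "(z \<cdot>\<^sub>m X) $$ (i, j) = (F * X + Y) $$ (i, j)" using eq by simp
    moreover have "((z \<cdot>\<^sub>m 1\<^sub>m k - F) * X) $$ (i, j) = (z \<cdot>\<^sub>m X - F * X) $$ (i, j)"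
      using F X by (simp add: minus_distrib_right_dim smult_left_dim)
    ultimately show "Y $$ (i, j) = ((z \<cdot>\<^sub>m 1\<^sub>m k - F) * X) $$ (i, j)"
      using ij F X Y by simp
  qed (use F X Y in auto)
  hence "resolvent F z * Y = (resolvent F z * (z \<cdot>\<^sub>m 1\<^sub>m k - F)) * X"
    using F X R(1) by (simp add: mult_assoc_dim)
  thus ?thesis using R X by simp
qed

lemma resolvent_state:
  assumes F: "F \<in> carrier_mat k k" and ev: "\<not> eigenvalue F z" and Y: "Y \<in> carrier_mat k c"
  shows "z \<cdot>\<^sub>m (resolvent F z * Y) = F * (resolvent F z * Y) + Y"
proof -
  have R: "resolvent F z \<in> carrier_mat k k" by (rule resolvent_inverse(1)[OF F ev])
  have "z \<cdot>\<^sub>m (resolvent F z * Y) = (z \<cdot>\<^sub>m resolvent F z) * Y"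
    using R Y by (simp add: smult_left_dim)
  also have "\<dots> = F * (resolvent F z * Y) + Y"
    unfolding resolvent_equation[OF F ev] using F R Y by (simp add: mat_expand)
  finally show ?thesis .
qed

lemma continuous_on_det:
  assumes "\<And>z. z \<in> S \<Longrightarrow> M z \<in> carrier_mat k k"
    and "\<And>i j. i < k \<Longrightarrow> j < k \<Longrightarrow> continuous_on S (\<lambda>z. M z $$ (i, j) :: complex)"
  shows "continuous_on S (\<lambda>z. det (M z))"
proof -
  have "continuous_on S (\<lambda>z. \<Sum>p | p permutes {0..<k}. signof p * (\<Prod>i = 0..<k. M z $$ (i, p i)))"
    by (intro continuous_intros assms(2)) (auto simp: permutes_in_image)
  moreover have "det (M z) = (\<Sum>p | p permutes {0..<k}. signof p * (\<Prod>i = 0..<k. M z $$ (i, p i)))"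
    if "z \<in> S" for z
    using det_def'[OF assms(1)[OF that]] .
  ultimately show ?thesis
    by (metis (no_types, lifting) continuous_on_cong)
qed

text \<open>Each entry is a cofactor, a polynomial in \<open>z\<close>, divided by a determinant without zeros.\<close>

lemma continuous_on_resolvent:
  assumes F: "F \<in> carrier_mat k k" and ev: "\<And>z. z \<in> S \<Longrightarrow> \<not> eigenvalue F z"
    and ij: "i < k" "j < k"
  shows "continuous_on S (\<lambda>z. resolvent F z $$ (i, j))"
proof -
  let ?M = "\<lambda>z. z \<cdot>\<^sub>m 1\<^sub>m k - F"
  have M: "?M z \<in> carrier_mat k k" for z using F by auto
  have cont: "continuous_on S (\<lambda>z. ?M z $$ (a, b))" if "a < k" "b < k" for a b
    using F that by (cases "a = b") (auto intro!: continuous_intros)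
  have "continuous_on S (\<lambda>z. det (mat_delete (?M z) j i))"
  proof (rule continuous_on_det)
    show "mat_delete (?M z) j i \<in> carrier_mat (k - 1) (k - 1)" for z
      using M[of z] by (rule mat_delete_carrier)
    show "continuous_on S (\<lambda>z. mat_delete (?M z) j i $$ (a, b))" if "a < k - 1" "b < k - 1" for a b
    proof -
      have "mat_delete (?M z) j i $$ (a, b)
          = ?M z $$ (if a < j then a else Suc a, if b < i then b else Suc b)" for z
        using that F by (simp add: mat_delete_def)
      thus ?thesis using that by (simp only:) (auto intro!: cont simp del: index_minus_mat)
    qed
  qed
  moreover have "continuous_on S (\<lambda>z. det (?M z))"
    by (rule continuous_on_det[OF M cont])
  ultimately have "continuous_on S (\<lambda>z. inverse (det (?M z)) *
      ((-1) ^ (j + i) * det (mat_delete (?M z) j i)))"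
    using det_pencil_nonzero[OF F ev] by (intro continuous_intros) auto
  moreover have "resolvent F z $$ (i, j) = inverse (det (?M z)) *
      ((-1) ^ (j + i) * det (mat_delete (?M z) j i))" if "z \<in> S" for z
  proof -
    have "dim_row F = k" using F by simp
    thus ?thesis
      using ij F matinv_adj_mat[OF M det_pencil_nonzero[OF F ev[OF that]]]
      by (simp add: resolvent_def adj_mat_def cofactor_def)
  qed
  ultimately show ?thesis
    by (metis (no_types, lifting) continuous_on_cong)
qed

section \<open>Stable matrices\<close>

lemma smult_pow_mat:
  fixes X :: "'a::comm_semiring_1 mat"
  assumes "X \<in> carrier_mat k k"
  shows "(a \<cdot>\<^sub>m X) ^\<^sub>m l = a ^ l \<cdot>\<^sub>m (X ^\<^sub>m l)"
proof (induction l)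
  case 0
  show ?case using assms by (intro eq_matI) auto
next
  case (Suc l)
  have X: "dim_row X = k" "dim_col X = k" "X ^\<^sub>m l \<in> carrier_mat k k"
    using assms by auto
  show ?case
    using X by (intro eq_matI) (auto simp: Suc smult_left_dim smult_right_dim mult.assoc mult.left_commute)
qed

text \<open>A spectral radius below 1 is known to keep the powers bounded. Applied to \<open>r\<^sup>-\<^sup>1F\<close> with \<open>r < 1\<close> still
  above the spectral radius of \<open>F\<close>, this gives geometric decay of the powers of \<open>F\<close>.\<close>

lemma stable_power_tendsto_zero:
  assumes F: "F \<in> carrier_mat k k" and st: "stable_mat F" and ij: "i < k" "j < k"
  shows "(\<lambda>l. (F ^\<^sub>m l) $$ (i, j)) \<longlonglongrightarrow> 0"
proof -
  have k: "k > 0" using ij by simp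
  have "spectral_radius F < 1"
    using spectral_radius_mem_max(1)[OF F k] st by (auto simp: spectrum_def stable_mat_def)
  then obtain r where r: "max 0 (spectral_radius F) < r" "r < 1"
    using dense[of "max 0 (spectral_radius F)" 1] by auto
  define Y where "Y = complex_of_real (1 / r) \<cdot>\<^sub>m F"
  have Y: "Y \<in> carrier_mat k k" using F by (simp add: Y_def)
  have FY: "F = complex_of_real r \<cdot>\<^sub>m Y"
    using r by (intro eq_matI) (auto simp: Y_def)
  have "spectral_radius Y < 1"
  proof -
    obtain c where c: "eigenvalue Y c" "spectral_radius Y = cmod c"
      using spectral_radius_mem_max(1)[OF Y k] by (auto simp: spectrum_def)
    then obtain v where v: "eigenvector Y v c" by (auto simp: eigenvalue_def)
    hence "v \<in> carrier_vec k" using Y by (simp add: eigenvector_def)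
    hence "F *\<^sub>v v = complex_of_real r \<cdot>\<^sub>v (Y *\<^sub>v v)"
      using Y by (intro eq_vecI) (auto simp: FY)
    hence "eigenvector F v (complex_of_real r * c)"
      using v F Y by (simp add: eigenvector_def smult_smult_assoc)
    hence "eigenvalue F (complex_of_real r * c)" by (auto simp: eigenvalue_def)
    hence "cmod (complex_of_real r * c) \<le> spectral_radius F"
      by (intro spectral_radius_mem_max(2)[OF F k]) (simp add: spectrum_def)
    also have "\<dots> < r" using r by simp
    finally show ?thesis using r c(2) by (simp add: norm_mult)
  qed
  then obtain c where c: "\<And>l. norm_bound (Y ^\<^sub>m l) c"
    using spectral_radius_jnf_norm_bound_less_1_upper_triangular[OF Y] by blast
  have "norm ((F ^\<^sub>m l) $$ (i, j)) \<le> c * r ^ l" for l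
  proof -
    have Yl: "Y ^\<^sub>m l \<in> carrier_mat k k" using Y by simp
    have "norm ((Y ^\<^sub>m l) $$ (i, j)) \<le> c"
      using c[of l] ij Y unfolding norm_bound_def by auto
    moreover have "(F ^\<^sub>m l) $$ (i, j) = complex_of_real r ^ l * (Y ^\<^sub>m l) $$ (i, j)"
      using ij Y Yl by (simp add: FY smult_pow_mat[OF Y])
    ultimately show ?thesis
      using r by (simp add: norm_mult norm_power mult.commute mult_right_mono)
  qed
  hence "\<forall>\<^sub>F l in sequentially. norm ((F ^\<^sub>m l) $$ (i, j)) \<le> c * r ^ l"
    by simp
  moreover have "(\<lambda>l. c * r ^ l) \<longlonglongrightarrow> 0"
    using r by (intro tendsto_mult_right_zero LIMSEQ_power_zero) auto
  ultimately show ?thesis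
    by (rule Lim_null_comparison)
qed

lemma stable_not_eigenvalue:
  "stable_mat F \<Longrightarrow> z \<in> unit_circle \<Longrightarrow> \<not> eigenvalue F z"
  by (auto simp: stable_mat_def)

lemma stable_block_lower_triangular:
  assumes F: "F \<in> carrier_mat m m" and X: "X \<in> carrier_mat n m" and Z: "Z \<in> carrier_mat n n"
    and "stable_mat F" "stable_mat Z"
  shows "stable_mat (four_block_mat F (0\<^sub>m m n) X Z)"
proof -
  have ev: "eigenvalue (four_block_mat F (0\<^sub>m m n) X Z) e \<longleftrightarrow> eigenvalue F e \<or> eigenvalue Z e" for e
  proof -
    have "char_matrix (four_block_mat F (0\<^sub>m m n) X Z) e
        = four_block_mat (char_matrix F e) (0\<^sub>m m n) X (char_matrix Z e)"
      using F X Z by (intro eq_matI) (auto simp: char_matrix_def)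
    moreover have "char_matrix F e \<in> carrier_mat m m" "char_matrix Z e \<in> carrier_mat n n"
      using F Z by (auto simp: char_matrix_def)
    moreover have "four_block_mat F (0\<^sub>m m n) X Z \<in> carrier_mat (m + n) (m + n)"
      using F Z by simp
    ultimately show ?thesis
      using eigenvalue_det[OF F] eigenvalue_det[OF Z] X
        eigenvalue_det[of "four_block_mat F (0\<^sub>m m n) X Z" "m + n" e]
      by (simp add: det_four_block_mat_upper_right_zero[of _ m _ n])
  qed
  thus ?thesis using assms by (auto simp: stable_mat_def)
qed

section \<open>Means over the unit circle\<close>

lemma integrable_on_circle:
  fixes f :: "complex \<Rightarrow> complex"
  assumes "continuous_on unit_circle f"
  shows "(\<lambda>\<theta>. f (cis \<theta>)) integrable_on {-pi..pi}"
  by (intro integrable_continuous_real continuous_on_compose2[OF assms] continuous_intros) auto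

lemma circle_mean_cong:
  "(\<And>z. z \<in> unit_circle \<Longrightarrow> f z = g z) \<Longrightarrow> circle_mean f = circle_mean g"
  by (simp add: circle_mean_def)

lemma circle_mean_add:
  fixes f g :: "complex \<Rightarrow> complex"
  assumes "continuous_on unit_circle f" "continuous_on unit_circle g"
  shows "circle_mean (\<lambda>z. f z + g z) = circle_mean f + circle_mean g"
  using assms[THEN integrable_on_circle]
  by (simp add: circle_mean_def integral_add scaleR_add_right)

lemma circle_mean_cmult:
  fixes f :: "complex \<Rightarrow> complex"
  shows "circle_mean (\<lambda>z. c * f z) = c * circle_mean f"
  by (simp add: circle_mean_def)

lemma circle_mean_sum:
  fixes f :: "'i \<Rightarrow> complex \<Rightarrow> complex"
  assumes "finite I" "\<And>a. a \<in> I \<Longrightarrow> continuous_on unit_circle (f a)"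
  shows "circle_mean (\<lambda>z. \<Sum>a\<in>I. f a z) = (\<Sum>a\<in>I. circle_mean (f a))"
  using assms integrable_on_circle
  by (simp add: circle_mean_def integral_sum scaleR_sum_right)

lemma circle_mean_cnj:
  "circle_mean (\<lambda>z. cnj (f z)) = cnj (circle_mean f)"
  by (simp add: circle_mean_def integral_cnj)

lemma circle_mean_const: "circle_mean (\<lambda>z. c :: complex) = c"
  by (simp add: circle_mean_def scaleR_conv_of_real)

text \<open>On the circle \<open>cnj z\<close> is \<open>z\<^sup>-\<^sup>1\<close>: the negative powers of \<open>z\<close> have no constant Fourier coefficient.\<close>

lemma circle_mean_cnj_power: "circle_mean (\<lambda>z. cnj z ^ Suc l) = 0"
proof -
  define c where "c = - (\<i> * of_nat (Suc l))"
  have c0: "c \<noteq> 0" by (simp add: c_def del: of_nat_Suc)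
  have exp: "cnj (cis \<theta>) ^ Suc l = exp (c * of_real \<theta>)" for \<theta>
  proof -
    have "cnj (cis \<theta>) ^ Suc l = cis (of_nat (Suc l) * (- \<theta>))"
      by (simp only: cis_cnj Complex.DeMoivre)
    also have "\<dots> = exp (c * of_real \<theta>)"
      by (simp add: cis_conv_exp c_def algebra_simps)
    finally show ?thesis .
  qed
  have "((\<lambda>\<theta>. exp (c * of_real \<theta>)) has_integral
      exp (c * of_real pi) / c - exp (c * of_real (-pi)) / c) {-pi..pi}"
  proof (rule fundamental_theorem_of_calculus)
    fix \<theta> :: real
    have "((\<lambda>z. exp (c * z) / c) has_field_derivative exp (c * of_real \<theta>)) (at (of_real \<theta>))"
      using c0 by (auto intro!: derivative_eq_intros)
    thus "((\<lambda>\<theta>. exp (c * of_real \<theta>) / c) has_vector_derivative exp (c * of_real \<theta>))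
        (at \<theta> within {-pi..pi})"
      by (rule has_vector_derivative_real_field)
  qed simp
  moreover have "exp (c * of_real pi) = exp (c * of_real (-pi))"
    unfolding exp[symmetric] by (simp add: complex_eq_iff)
  ultimately show ?thesis
    by (simp only: circle_mean_def exp) (simp add: integral_unique)
qed

lemma norm_circle_mean_le:
  fixes f :: "complex \<Rightarrow> complex"
  assumes "continuous_on unit_circle f" "\<And>z. z \<in> unit_circle \<Longrightarrow> norm (f z) \<le> C"
  shows "norm (circle_mean f) \<le> C"
proof -
  have "C \<ge> norm (f 1)" by (rule assms(2)) simp
  hence "0 \<le> C" using norm_ge_zero order_trans by blast
  hence "norm (integral {-pi..pi} (\<lambda>\<theta>. f (cis \<theta>))) \<le> C * (pi - (-pi))"
    using integrable_integral[OF integrable_on_circle[OF assms(1)]]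
    by (intro integral_bound continuous_on_compose2[OF assms(1)] continuous_intros) (auto intro: assms(2))
  thus ?thesis by (simp add: circle_mean_def field_simps)
qed

definition continuous_mat :: "nat \<Rightarrow> (complex \<Rightarrow> complex mat) \<Rightarrow> bool" where
  "continuous_mat k M \<longleftrightarrow> (\<forall>z\<in>unit_circle. M z \<in> carrier_mat k k) \<and>
     (\<forall>i<k. \<forall>j<k. continuous_on unit_circle (\<lambda>z. M z $$ (i, j)))"

lemma continuous_matD:
  assumes "continuous_mat k M"
  shows "z \<in> unit_circle \<Longrightarrow> M z \<in> carrier_mat k k"
    "z \<in> unit_circle \<Longrightarrow> dim_row (M z) = k" "z \<in> unit_circle \<Longrightarrow> dim_col (M z) = k"
    "i < k \<Longrightarrow> j < k \<Longrightarrow> continuous_on unit_circle (\<lambda>z. M z $$ (i, j))"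
  using assms by (auto simp: continuous_mat_def simp del: mem_sphere_0)

lemma circle_mean_mat_carrier [simp]:
  "circle_mean_mat k M \<in> carrier_mat k k"
  "dim_row (circle_mean_mat k M) = k" "dim_col (circle_mean_mat k M) = k"
  by (simp_all add: circle_mean_mat_def)

lemma circle_mean_mat_cong:
  "(\<And>z. z \<in> unit_circle \<Longrightarrow> M z = N z) \<Longrightarrow> circle_mean_mat k M = circle_mean_mat k N"
  by (auto simp: circle_mean_mat_def intro!: eq_matI circle_mean_cong)

lemma continuous_mat_mult:
  assumes M: "continuous_mat k M" and N: "continuous_mat k N"
  shows "continuous_mat k (\<lambda>z. M z * N z)"
  unfolding continuous_mat_def
proof (intro conjI ballI allI impI)
  fix i j assume ij: "i < k" "j < k"
  have "continuous_on unit_circle (\<lambda>z. \<Sum>a<k. M z $$ (i, a) * N z $$ (a, j))"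
    using M N ij by (intro continuous_intros) (auto simp: continuous_matD simp del: mem_sphere_0)
  moreover have "(M z * N z) $$ (i, j) = (\<Sum>a<k. M z $$ (i, a) * N z $$ (a, j))"
    if "z \<in> unit_circle" for z
    using M N ij that by (intro index_mult_sum) (auto simp: continuous_matD simp del: mem_sphere_0)
  ultimately show "continuous_on unit_circle (\<lambda>z. (M z * N z) $$ (i, j))"
    by (metis (no_types, lifting) continuous_on_cong)
qed (use M N in \<open>auto simp: continuous_matD simp del: mem_sphere_0\<close>)

lemma continuous_mat_add:
  assumes M: "continuous_mat k M" and N: "continuous_mat k N"
  shows "continuous_mat k (\<lambda>z. M z + N z)"
  unfolding continuous_mat_def
proof (intro conjI ballI allI impI)
  fix i j assume ij: "i < k" "j < k"
  have "continuous_on unit_circle (\<lambda>z. M z $$ (i, j) + N z $$ (i, j))"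
    using M N ij by (intro continuous_intros) (auto simp: continuous_matD simp del: mem_sphere_0)
  moreover have "(M z + N z) $$ (i, j) = M z $$ (i, j) + N z $$ (i, j)" if "z \<in> unit_circle" for z
    using M N ij that by (auto simp: continuous_matD simp del: mem_sphere_0)
  ultimately show "continuous_on unit_circle (\<lambda>z. (M z + N z) $$ (i, j))"
    by (metis (no_types, lifting) continuous_on_cong)
qed (use M N in \<open>auto simp: continuous_matD simp del: mem_sphere_0\<close>)

lemma continuous_mat_const: "X \<in> carrier_mat k k \<Longrightarrow> continuous_mat k (\<lambda>z. X)"
  by (simp add: continuous_mat_def)

lemma continuous_mat_smult:
  assumes f: "continuous_on unit_circle f" and M: "continuous_mat k M"
  shows "continuous_mat k (\<lambda>z. f z \<cdot>\<^sub>m M z)"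
  unfolding continuous_mat_def
proof (intro conjI ballI allI impI)
  fix i j assume ij: "i < k" "j < k"
  have "continuous_on unit_circle (\<lambda>z. f z * M z $$ (i, j))"
    using M f ij by (intro continuous_intros) (auto simp: continuous_matD simp del: mem_sphere_0)
  moreover have "(f z \<cdot>\<^sub>m M z) $$ (i, j) = f z * M z $$ (i, j)" if "z \<in> unit_circle" for z
    using M ij that by (auto simp: continuous_matD simp del: mem_sphere_0)
  ultimately show "continuous_on unit_circle (\<lambda>z. (f z \<cdot>\<^sub>m M z) $$ (i, j))"
    by (metis (no_types, lifting) continuous_on_cong)
qed (use M in \<open>auto simp: continuous_matD simp del: mem_sphere_0\<close>)

lemma continuous_mat_adjoint:
  assumes M: "continuous_mat k M"
  shows "continuous_mat k (\<lambda>z. mat_adjoint (M z))"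
  unfolding continuous_mat_def
proof (intro conjI ballI allI impI)
  fix i j assume ij: "i < k" "j < k"
  have "continuous_on unit_circle (\<lambda>z. cnj (M z $$ (j, i)))"
    using M ij by (intro continuous_intros) (auto simp: continuous_matD simp del: mem_sphere_0)
  moreover have "mat_adjoint (M z) $$ (i, j) = cnj (M z $$ (j, i))" if "z \<in> unit_circle" for z
    using M ij that by (auto simp: continuous_matD simp del: mem_sphere_0)
  ultimately show "continuous_on unit_circle (\<lambda>z. mat_adjoint (M z) $$ (i, j))"
    by (metis (no_types, lifting) continuous_on_cong)
qed (use M in \<open>auto simp: continuous_matD simp del: mem_sphere_0\<close>)

lemma continuous_mat_resolvent:
  assumes F: "F \<in> carrier_mat k k" and st: "stable_mat F"
  shows "continuous_mat k (resolvent F)"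
proof -
  note ev = stable_not_eigenvalue[OF st]
  show ?thesis
    unfolding continuous_mat_def
    by (intro conjI ballI allI impI resolvent_inverse(1)[OF F] continuous_on_resolvent[OF F]) (use ev in auto)
qed

lemma circle_mean_mat_add:
  assumes M: "continuous_mat k M" and N: "continuous_mat k N"
  shows "circle_mean_mat k (\<lambda>z. M z + N z) = circle_mean_mat k M + circle_mean_mat k N"
proof (rule eq_matI)
  fix i j assume "i < dim_row (circle_mean_mat k M + circle_mean_mat k N)"
    "j < dim_col (circle_mean_mat k M + circle_mean_mat k N)"
  hence ij: "i < k" "j < k" by auto
  have "circle_mean (\<lambda>z. (M z + N z) $$ (i, j)) = circle_mean (\<lambda>z. M z $$ (i, j) + N z $$ (i, j))"
    using M N ij by (intro circle_mean_cong) (auto simp: continuous_matD simp del: mem_sphere_0)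
  also have "\<dots> = circle_mean (\<lambda>z. M z $$ (i, j)) + circle_mean (\<lambda>z. N z $$ (i, j))"
    using M N ij by (intro circle_mean_add) (auto simp: continuous_matD simp del: mem_sphere_0)
  finally show "circle_mean_mat k (\<lambda>z. M z + N z) $$ (i, j)
      = (circle_mean_mat k M + circle_mean_mat k N) $$ (i, j)"
    using ij by (simp add: circle_mean_mat_def)
qed auto

lemma circle_mean_mat_const:
  "X \<in> carrier_mat k k \<Longrightarrow> circle_mean_mat k (\<lambda>z. X) = X"
  by (intro eq_matI) (auto simp: circle_mean_mat_def circle_mean_const)

lemma circle_mean_mat_mult_left:
  assumes M: "continuous_mat k M" and X: "X \<in> carrier_mat k k"
  shows "circle_mean_mat k (\<lambda>z. X * M z) = X * circle_mean_mat k M"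
proof (rule eq_matI)
  fix i j assume "i < dim_row (X * circle_mean_mat k M)" "j < dim_col (X * circle_mean_mat k M)"
  hence ij: "i < k" "j < k" using X by auto
  have "circle_mean (\<lambda>z. (X * M z) $$ (i, j)) = circle_mean (\<lambda>z. \<Sum>a<k. X $$ (i, a) * M z $$ (a, j))"
    using M X ij by (intro circle_mean_cong index_mult_sum) (auto simp: continuous_matD simp del: mem_sphere_0)
  also have "\<dots> = (\<Sum>a<k. X $$ (i, a) * circle_mean (\<lambda>z. M z $$ (a, j)))"
    using M ij by (subst circle_mean_sum)
      (auto simp: continuous_matD simp del: mem_sphere_0 simp: circle_mean_cmult intro!: continuous_intros)
  also have "\<dots> = (X * circle_mean_mat k M) $$ (i, j)"
    using X ij by (subst index_mult_sum[of _ k k]) (auto simp: circle_mean_mat_def)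
  finally show "circle_mean_mat k (\<lambda>z. X * M z) $$ (i, j) = (X * circle_mean_mat k M) $$ (i, j)"
    using ij by (simp add: circle_mean_mat_def)
qed (use X in auto)

lemma circle_mean_mat_adjoint:
  assumes "continuous_mat k M"
  shows "circle_mean_mat k (\<lambda>z. mat_adjoint (M z)) = mat_adjoint (circle_mean_mat k M)"
proof (rule eq_matI)
  fix i j assume "i < dim_row (mat_adjoint (circle_mean_mat k M))"
    "j < dim_col (mat_adjoint (circle_mean_mat k M))"
  hence ij: "i < k" "j < k" by auto
  have "circle_mean (\<lambda>z. mat_adjoint (M z) $$ (i, j)) = circle_mean (\<lambda>z. cnj (M z $$ (j, i)))"
    using assms ij by (intro circle_mean_cong) (auto simp: continuous_matD simp del: mem_sphere_0)
  thus "circle_mean_mat k (\<lambda>z. mat_adjoint (M z)) $$ (i, j) = mat_adjoint (circle_mean_mat k M) $$ (i, j)"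
    using ij by (simp add: circle_mean_mat_def circle_mean_cnj)
qed auto

text \<open>The adjoint exchanges left and right factors.\<close>

lemma circle_mean_mat_mult_right:
  assumes M: "continuous_mat k M" and X: "X \<in> carrier_mat k k"
  shows "circle_mean_mat k (\<lambda>z. M z * X) = circle_mean_mat k M * X"
proof -
  have X': "mat_adjoint X \<in> carrier_mat k k" using X by simp
  have "circle_mean_mat k (\<lambda>z. M z * X)
      = circle_mean_mat k (\<lambda>z. mat_adjoint (mat_adjoint X * mat_adjoint (M z)))"
    using M X by (intro circle_mean_mat_cong) (auto simp: continuous_matD adjoint_mult simp del: mem_sphere_0)
  also have "\<dots> = mat_adjoint (mat_adjoint X * mat_adjoint (circle_mean_mat k M))"
    using M X' by (simp add: circle_mean_mat_adjoint circle_mean_mat_mult_left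
        continuous_mat_mult continuous_mat_const continuous_mat_adjoint)
  also have "\<dots> = circle_mean_mat k M * X"
    using X by (simp add: adjoint_mult)
  finally show ?thesis .
qed

section \<open>The Lyapunov equation\<close>

lemma tendsto_zero_mult_bounded_mat:
  assumes X: "\<And>l. X l \<in> carrier_mat k k" and Y: "\<And>l. Y l \<in> carrier_mat k k"
    and lim: "\<And>a. a < k \<Longrightarrow> (\<lambda>l. X l $$ (i, a)) \<longlonglongrightarrow> (0 :: complex)"
    and bdd: "\<And>a. a < k \<Longrightarrow> Bseq (\<lambda>l. Y l $$ (a, j))"
    and ij: "i < k" "j < k"
  shows "(\<lambda>l. (X l * Y l) $$ (i, j)) \<longlonglongrightarrow> 0"
proof -
  have "(\<lambda>l. \<Sum>a<k. X l $$ (i, a) * Y l $$ (a, j)) \<longlonglongrightarrow> (\<Sum>a<k. 0)"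
  proof (intro tendsto_sum)
    fix a assume "a \<in> {..<k}"
    hence "Zfun (\<lambda>l. X l $$ (i, a)) sequentially" "Bfun (\<lambda>l. Y l $$ (a, j)) sequentially"
      using lim bdd by (auto simp: tendsto_Zfun_iff)
    thus "(\<lambda>l. X l $$ (i, a) * Y l $$ (a, j)) \<longlonglongrightarrow> 0"
      using bounded_bilinear.Zfun_prod_Bfun[OF bounded_bilinear_mult]
      by (simp add: tendsto_Zfun_iff)
  qed
  thus ?thesis
    using index_mult_sum[OF X Y ij] by simp
qed

text \<open>The function \<open>R\<close> is analytic outside the disc and vanishes at infinity, so its constant Fourier
  coefficient is zero. This is shown by a shift: if \<open>J\<^sub>l\<close> is the mean of
  \<open>z\<^sup>-\<^sup>lR\<close>, then \<open>zR = FR + I\<close> gives \<open>J\<^sub>l = F J\<^sub>l\<^sub>+\<^sub>1\<close>, hence \<open>J\<^sub>0 = F\<^sup>l J\<^sub>l\<close>, where the \<open>J\<^sub>l\<close> are bounded and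
  \<open>F\<^sup>l\<close> tends to zero.\<close>

lemma circle_mean_resolvent:
  assumes F: "F \<in> carrier_mat k k" and st: "stable_mat F"
  shows "circle_mean_mat k (resolvent F) = 0\<^sub>m k k"
proof -
  note ev = stable_not_eigenvalue[OF st]
  define M where "M l z = cnj z ^ l \<cdot>\<^sub>m resolvent F z" for l z
  define J where "J l = circle_mean_mat k (M l)" for l
  have R: "continuous_mat k (resolvent F)"
    by (rule continuous_mat_resolvent[OF F st])
  have cM: "continuous_mat k (M l)" for l
    unfolding M_def by (intro continuous_mat_smult R continuous_intros)
  have J: "J l \<in> carrier_mat k k" for l by (simp add: J_def)
  have step: "J l = F * J (Suc l)" for l
  proof -
    have eq: "M l z = F * M (Suc l) z + cnj z ^ Suc l \<cdot>\<^sub>m 1\<^sub>m k" if z: "z \<in> unit_circle" for z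
    proof -
      have "cnj z * z = 1"
        using z complex_norm_square[of z] by (simp add: mult.commute)
      hence "M l z = cnj z ^ Suc l \<cdot>\<^sub>m (z \<cdot>\<^sub>m resolvent F z)"
        by (intro eq_matI) (auto simp: M_def)
      also have "\<dots> = cnj z ^ Suc l \<cdot>\<^sub>m (F * resolvent F z + 1\<^sub>m k)"
        by (simp only: resolvent_equation[OF F ev[OF z]])
      also have "\<dots> = F * M (Suc l) z + cnj z ^ Suc l \<cdot>\<^sub>m 1\<^sub>m k"
        unfolding M_def using F resolvent_inverse(1)[OF F ev[OF z]]
        by (simp add: smult_right_dim add_smult_distrib_left_mat[of _ k k])
      finally show ?thesis .
    qed
    have "circle_mean_mat k (\<lambda>z. cnj z ^ Suc l \<cdot>\<^sub>m 1\<^sub>m k) = 0\<^sub>m k k"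
    proof (rule eq_matI)
      fix i j assume "i < dim_row (0\<^sub>m k k)" "j < dim_col (0\<^sub>m k k)"
      thus "circle_mean_mat k (\<lambda>z. cnj z ^ Suc l \<cdot>\<^sub>m 1\<^sub>m k) $$ (i, j) = 0\<^sub>m k k $$ (i, j)"
        using circle_mean_cnj_power[of l] circle_mean_const[of 0]
        by (cases "i = j") (simp_all add: circle_mean_mat_def)
    qed auto
    moreover have "J l = circle_mean_mat k (\<lambda>z. F * M (Suc l) z + cnj z ^ Suc l \<cdot>\<^sub>m 1\<^sub>m k)"
      unfolding J_def by (intro circle_mean_mat_cong eq)
    ultimately show ?thesis
      using F cM by (simp add: J_def circle_mean_mat_add circle_mean_mat_mult_left continuous_mat_mult
        continuous_mat_const continuous_mat_smult continuous_intros del: power_Suc)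
  qed
  have iter: "J 0 = F ^\<^sub>m l * J l" for l
  proof (induction l)
    case (Suc l)
    have "F ^\<^sub>m l * (F * J (Suc l)) = F ^\<^sub>m Suc l * J (Suc l)"
      using F J[of "Suc l"] by (simp add: mult_assoc_dim)
    thus ?case using Suc step[of l] by simp
  qed (use F J[of 0] in simp)
  have "J 0 $$ (i, j) = 0" if ij: "i < k" "j < k" for i j
  proof -
    have "Bseq (\<lambda>l. J l $$ (a, j))" if a: "a < k" for a
    proof -
      have cont: "continuous_on unit_circle (\<lambda>z. resolvent F z $$ (a, j))"
        using R a ij by (auto simp: continuous_matD simp del: mem_sphere_0)
      have "compact ((\<lambda>z. resolvent F z $$ (a, j)) ` unit_circle)"
        by (intro compact_continuous_image cont) simp
      then obtain C where C: "\<And>z. z \<in> unit_circle \<Longrightarrow> norm (resolvent F z $$ (a, j)) \<le> C"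
        using compact_imp_bounded bounded_iff by (metis imageI)
      have "norm (J l $$ (a, j)) \<le> C" for l
      proof -
        have "norm (circle_mean (\<lambda>z. M l z $$ (a, j))) \<le> C"
        proof (rule norm_circle_mean_le)
          show "continuous_on unit_circle (\<lambda>z. M l z $$ (a, j))"
            using a ij by (intro continuous_matD(4)[OF cM])
          show "norm (M l z $$ (a, j)) \<le> C" if z: "z \<in> unit_circle" for z
            using C[OF z] resolvent_inverse(1)[OF F ev[OF z]] a ij z
            by (simp add: M_def norm_mult norm_power)
        qed
        thus ?thesis using a ij by (simp add: J_def circle_mean_mat_def)
      qed
      thus ?thesis by (intro BseqI') auto
    qed
    hence "(\<lambda>l. (F ^\<^sub>m l * J l) $$ (i, j)) \<longlonglongrightarrow> 0"
      using F J ij by (intro tendsto_zero_mult_bounded_mat[where k = k] stable_power_tendsto_zero[OF F st]) auto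
    thus ?thesis
      using LIMSEQ_unique[OF tendsto_const] by (simp flip: iter)
  qed
  moreover have "J 0 = circle_mean_mat k (resolvent F)"
    unfolding J_def by (intro circle_mean_mat_cong eq_matI) (auto simp: M_def)
  ultimately show ?thesis
    by (intro eq_matI) auto
qed

text \<open>Iterating the equation gives \<open>X = F\<^sup>l X (F\<^sup>l)\<^sup>*\<close>, which tends to zero.\<close>

lemma lyapunov_homogeneous:
  assumes F: "F \<in> carrier_mat k k" and st: "stable_mat F"
    and X: "X \<in> carrier_mat k k" and eq: "X = F * X * mat_adjoint F"
  shows "X = 0\<^sub>m k k"
proof -
  have iter: "X = F ^\<^sub>m l * (X * mat_adjoint (F ^\<^sub>m l))" for l
  proof (induction l)
    case (Suc l)
    have Fl: "F ^\<^sub>m l \<in> carrier_mat k k" using F by simp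
    have "X = F ^\<^sub>m l * ((F * X * mat_adjoint F) * mat_adjoint (F ^\<^sub>m l))"
      using Suc eq by simp
    also have "\<dots> = F ^\<^sub>m Suc l * (X * mat_adjoint (F ^\<^sub>m Suc l))"
      using F X Fl by (simp add: mult_assoc_dim adjoint_mult)
    finally show ?case .
  qed (use F X in simp)
  have "X $$ (i, j) = 0" if ij: "i < k" "j < k" for i j
  proof -
    have Fl: "F ^\<^sub>m l \<in> carrier_mat k k" for l using F by simp
    have "Bseq (\<lambda>l. (X * mat_adjoint (F ^\<^sub>m l)) $$ (a, j))" if a: "a < k" for a
    proof -
      have "(\<lambda>l. \<Sum>b<k. X $$ (a, b) * cnj ((F ^\<^sub>m l) $$ (j, b)))
          \<longlonglongrightarrow> (\<Sum>b<k. X $$ (a, b) * cnj 0)"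
        using ij by (intro tendsto_intros stable_power_tendsto_zero[OF F st]) auto
      moreover have "(X * mat_adjoint (F ^\<^sub>m l)) $$ (a, j)
          = (\<Sum>b<k. X $$ (a, b) * cnj ((F ^\<^sub>m l) $$ (j, b)))" for l
      proof -
        have "mat_adjoint (F ^\<^sub>m l) $$ (b, j) = cnj ((F ^\<^sub>m l) $$ (j, b))" if "b < k" for b
          using index_adjoint[of b "F ^\<^sub>m l" j] carrier_matD[OF Fl[of l]] ij that by simp
        moreover have "(X * mat_adjoint (F ^\<^sub>m l)) $$ (a, j)
            = (\<Sum>b<k. X $$ (a, b) * mat_adjoint (F ^\<^sub>m l) $$ (b, j))"
          by (rule index_mult_sum[OF X adjoint_carrier[OF Fl] a ij(2)])
        ultimately show ?thesis by simp
      qed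
      ultimately have "(\<lambda>l. (X * mat_adjoint (F ^\<^sub>m l)) $$ (a, j))
          \<longlonglongrightarrow> (\<Sum>b<k. X $$ (a, b) * cnj 0)"
        by presburger
      thus ?thesis
        by (intro convergent_imp_Bseq convergentI)
    qed
    hence "(\<lambda>l. (F ^\<^sub>m l * (X * mat_adjoint (F ^\<^sub>m l))) $$ (i, j)) \<longlonglongrightarrow> 0"
      by (intro tendsto_zero_mult_bounded_mat[where k = k] stable_power_tendsto_zero[OF F st] Fl ij
          mult_carrier_mat[OF X adjoint_carrier[OF Fl]])
    thus ?thesis
      using LIMSEQ_unique[OF tendsto_const] by (simp flip: iter)
  qed
  thus ?thesis using X by (intro eq_matI) auto
qed

text \<open>Multiplying \<open>R\<close> by the unimodular \<open>z\<close> leaves \<open>RQR\<^sup>*\<close> unchanged, and \<open>zR = FR + I\<close> expands the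
  product into \<open>F(RQR\<^sup>*)F\<^sup>* + FRQ + QR\<^sup>*F\<^sup>* + Q\<close>. The two middle terms have mean zero.\<close>

lemma circle_mean_gramian:
  assumes F: "F \<in> carrier_mat k k" and st: "stable_mat F" and Q: "Q \<in> carrier_mat k k"
  defines "S \<equiv> circle_mean_mat k (\<lambda>z. resolvent F z * Q * mat_adjoint (resolvent F z))"
  shows "S = F * S * mat_adjoint F + Q"
proof -
  let ?R = "resolvent F"
  let ?T = "\<lambda>z. ?R z * Q * mat_adjoint (?R z)"
  note ev = stable_not_eigenvalue[OF st]
  have F': "mat_adjoint F \<in> carrier_mat k k" using F by simp
  have R: "continuous_mat k ?R" by (rule continuous_mat_resolvent[OF F st])
  note cont = continuous_mat_mult continuous_mat_const continuous_mat_adjoint R F F' Q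
  have cT: "continuous_mat k ?T" by (intro cont)
  have pw: "?T z = F * (?T z * mat_adjoint F) + (F * (?R z * Q) + (Q * mat_adjoint (?R z)) * mat_adjoint F) + Q"
    (is "_ = ?E z")
    if z: "z \<in> unit_circle" for z
  proof -
    have Rz: "?R z \<in> carrier_mat k k" "dim_row (?R z) = k" "dim_col (?R z) = k"
      using resolvent_inverse(1)[OF F ev[OF z]] by auto
    have "z * cnj z = 1" using z complex_norm_square[of z] by simp
    hence "?T z = (z \<cdot>\<^sub>m ?R z) * Q * mat_adjoint (z \<cdot>\<^sub>m ?R z)"
      using Rz Q by (simp add: adjoint_smult smult_left_dim smult_right_dim smult_smult_mat one_smult_mat mult.commute
          del: index_mult_mat(1))
    also have "\<dots> = (F * ?R z + 1\<^sub>m k) * Q * mat_adjoint (F * ?R z + 1\<^sub>m k)"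
      by (simp only: resolvent_equation[OF F ev[OF z]])
    also have "\<dots> = ?E z"
      using Rz F Q by (intro eq_matI) (auto simp: adjoint_add adjoint_mult mult_assoc_dim
          distrib_left_dim distrib_right_dim algebra_simps simp del: index_mult_mat(1))
    finally show ?thesis .
  qed
  have S: "S \<in> carrier_mat k k" by (simp add: S_def)
  have "S = circle_mean_mat k ?E"
    unfolding S_def by (rule circle_mean_mat_cong[OF pw])
  also have "\<dots> = circle_mean_mat k (\<lambda>z. F * (?T z * mat_adjoint F))
      + (circle_mean_mat k (\<lambda>z. F * (?R z * Q))
        + circle_mean_mat k (\<lambda>z. (Q * mat_adjoint (?R z)) * mat_adjoint F)) + Q"
    by (simp only: circle_mean_mat_add continuous_mat_add circle_mean_mat_const cont)
  also have "circle_mean_mat k (\<lambda>z. F * (?T z * mat_adjoint F)) = F * (S * mat_adjoint F)"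
    unfolding S_def by (simp only: circle_mean_mat_mult_left circle_mean_mat_mult_right cont)
  also have "circle_mean_mat k (\<lambda>z. F * (?R z * Q)) = 0\<^sub>m k k"
  proof -
    have "circle_mean_mat k (\<lambda>z. F * (?R z * Q)) = F * (circle_mean_mat k ?R * Q)"
      by (simp only: circle_mean_mat_mult_left circle_mean_mat_mult_right cont)
    thus ?thesis using F Q circle_mean_resolvent[OF F st] by simp
  qed
  also have "circle_mean_mat k (\<lambda>z. (Q * mat_adjoint (?R z)) * mat_adjoint F) = 0\<^sub>m k k"
  proof -
    have "circle_mean_mat k (\<lambda>z. mat_adjoint (?R z)) = 0\<^sub>m k k"
      using circle_mean_mat_adjoint[OF R] circle_mean_resolvent[OF F st]
      by (intro eq_matI) auto
    moreover have "circle_mean_mat k (\<lambda>z. (Q * mat_adjoint (?R z)) * mat_adjoint F)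
        = (Q * circle_mean_mat k (\<lambda>z. mat_adjoint (?R z))) * mat_adjoint F"
      by (simp only: circle_mean_mat_mult_left circle_mean_mat_mult_right cont)
    ultimately show ?thesis using F Q by simp
  qed
  finally show ?thesis
    using F F' Q S by (simp add: mult_assoc_dim)
qed

lemma circle_mean_gramian_eq:
  assumes F: "F \<in> carrier_mat k k" and st: "stable_mat F" and Q: "Q \<in> carrier_mat k k"
    and X: "X \<in> carrier_mat k k" and eq: "X = F * X * mat_adjoint F + Q"
  shows "circle_mean_mat k (\<lambda>z. resolvent F z * Q * mat_adjoint (resolvent F z)) = X"
proof -
  define S where "S = circle_mean_mat k (\<lambda>z. resolvent F z * Q * mat_adjoint (resolvent F z))"
  have S: "S \<in> carrier_mat k k" "S = F * S * mat_adjoint F + Q"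
    using circle_mean_gramian[OF F st Q] by (simp_all add: S_def)
  have "X - S = (F * X * mat_adjoint F + Q) - (F * S * mat_adjoint F + Q)"
    using eq S(2) by simp
  also have "\<dots> = F * X * mat_adjoint F - F * S * mat_adjoint F"
    using F X S(1) Q by (intro eq_matI) (auto simp del: index_mult_mat(1))
  also have "\<dots> = F * (X - S) * mat_adjoint F"
    using F X S(1) by (simp add: minus_distrib_left_dim minus_distrib_right_dim)
  finally have "X - S = 0\<^sub>m k k"
    using F X S(1) by (intro lyapunov_homogeneous[OF F st]) auto
  hence diff: "(X - S) $$ (i, j) = 0\<^sub>m k k $$ (i, j)" for i j by simp
  show ?thesis
    unfolding S_def[symmetric]
  proof (rule eq_matI)
    fix i j assume "i < dim_row X" "j < dim_col X"
    thus "S $$ (i, j) = X $$ (i, j)" using diff[of i j] X S(1) by simp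
  qed (use X S(1) in auto)
qed

section \<open>Spectral factorization by the Riccati equation\<close>

text \<open>The form \<open>g\<^sup>*Pg\<close> is computed twice: once
  as \<open>(zg)\<^sup>*P(zg)\<close> with \<open>zg = Ag + B\<close>, using \<open>|z| = 1\<close>, and once by substituting the Riccati equation for \<open>P\<close>. In the
  difference \<open>(Ag)\<^sup>*P(Ag)\<close> cancels, and completing the square gives \<open>b g\<^sup>*\<Lambda>g = |b + v|\<^sup>2\<close>.\<close>

lemma riccati_factorization:
  fixes A B \<Lambda> P g :: "complex mat"
  assumes A: "A \<in> carrier_mat n n" and B: "B \<in> carrier_mat n 1"
    and P: "P \<in> hermitian_mats n" and L: "\<Lambda> \<in> carrier_mat n n"
    and are: "riccati_equation A B \<Lambda> P"
    and b: "mat_adjoint B * P * B = b \<cdot>\<^sub>m 1\<^sub>m 1" "b \<noteq> 0" "b \<in> \<real>"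
    and g: "g \<in> carrier_mat n 1" and z: "cmod z = 1" and zg: "z \<cdot>\<^sub>m g = A * g + B"
  defines "v \<equiv> (mat_adjoint B * P * A * g) $$ (0, 0)"
  shows "b * (mat_adjoint g * \<Lambda> * g) $$ (0, 0) = (b + v) * cnj (b + v)"
proof -
  have P': "P \<in> carrier_mat n n" "mat_adjoint P = P"
    using P by (auto simp: hermitian_mats_def)
  note dims = carrier_matD[OF A] carrier_matD[OF B] carrier_matD[OF P'(1)] carrier_matD[OF L] carrier_matD[OF g]
  define V where "V = mat_adjoint B * P * A * g"
  define a where "a = A * g"
  have V: "V \<in> carrier_mat 1 1" and a: "a \<in> carrier_mat n 1"
    using A B P' g by (auto simp: V_def a_def)
  have Va: "V = mat_adjoint B * (P * a)"
    by (simp add: V_def a_def mult_assoc_dim dims)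
  have V': "mat_adjoint V = mat_adjoint a * (P * B)"
    using a by (simp add: Va adjoint_mult P' dims mult_assoc_dim)
  have inv: "matinv (mat_adjoint B * P * B) = inverse b \<cdot>\<^sub>m 1\<^sub>m 1"
    unfolding b(1) using matinv_scalar[OF b(2)] .
  have "mat_adjoint g * P * g = mat_adjoint (z \<cdot>\<^sub>m g) * P * (z \<cdot>\<^sub>m g)"
    using z complex_norm_square[of z]
    by (intro eq_matI) (simp_all add: adjoint_smult smult_left_dim smult_right_dim dims smult_smult_mat mult.commute
        del: index_mult_mat(1))
  also have "\<dots> = mat_adjoint a * P * a + mat_adjoint V + V + b \<cdot>\<^sub>m 1\<^sub>m 1"
    unfolding zg a_def[symmetric] b(1)[symmetric] using a V
    by (intro eq_matI) (auto simp: adjoint_add Va[symmetric] V'[symmetric] dims mult_assoc_dim distrib_left_dim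
        distrib_right_dim algebra_simps simp del: index_mult_mat(1))
  finally have gPg: "mat_adjoint g * P * g = mat_adjoint a * P * a + mat_adjoint V + V + b \<cdot>\<^sub>m 1\<^sub>m 1" .
  have gLg: "mat_adjoint g * P * g = mat_adjoint a * P * a - inverse b \<cdot>\<^sub>m (mat_adjoint V * V) + mat_adjoint g * \<Lambda> * g"
  proof -
    have "P = mat_adjoint A * P * A - inverse b \<cdot>\<^sub>m (mat_adjoint A * P * B * mat_adjoint B * P * A) + \<Lambda>"
      using are unfolding riccati_equation_def inv by (simp add: smult_left_dim smult_right_dim dims)
    hence "mat_adjoint g * P * g = mat_adjoint g * (mat_adjoint A * P * A
        - inverse b \<cdot>\<^sub>m (mat_adjoint A * P * B * mat_adjoint B * P * A) + \<Lambda>) * g"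
      by simp
    also have "\<dots> = mat_adjoint a * P * a - inverse b \<cdot>\<^sub>m (mat_adjoint V * V) + mat_adjoint g * \<Lambda> * g"
      by (simp add: Va V' a_def adjoint_mult P'(2) dims mat_expand)
    finally show ?thesis .
  qed
  have V00: "V $$ (0, 0) = v" "mat_adjoint V $$ (0, 0) = cnj v" "(mat_adjoint V * V) $$ (0, 0) = cnj v * v"
    using V by (simp_all add: v_def V_def[symmetric] scalar_prod_def)
  have "(mat_adjoint a * P * a + mat_adjoint V + V + b \<cdot>\<^sub>m 1\<^sub>m 1) $$ (0, 0)
      = (mat_adjoint a * P * a - inverse b \<cdot>\<^sub>m (mat_adjoint V * V) + mat_adjoint g * \<Lambda> * g) $$ (0, 0)"
    using gPg gLg by simp
  hence "(mat_adjoint a * P * a) $$ (0, 0) + cnj v + v + b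
      = (mat_adjoint a * P * a) $$ (0, 0) - inverse b * (cnj v * v) + (mat_adjoint g * \<Lambda> * g) $$ (0, 0)"
    using V a by (simp add: V00 dims del: index_mult_mat(1))
  hence "(mat_adjoint g * \<Lambda> * g) $$ (0, 0) = b + v + cnj v + inverse b * (cnj v * v)"
    by (simp add: algebra_simps)
  thus ?thesis
    using b(2,3) by (simp add: field_simps Reals_cnj_iff)
qed

text \<open>The state \<open>g\<close> of \<open>(A, B)\<close> under unit input is the state of \<open>(Z, B)\<close> under the input \<open>1 + v/b\<close>,
  because \<open>Zg = Ag - (v/b) B\<close>.\<close>

lemma closed_loop_shift:
  fixes A B P g :: "complex mat"
  assumes A: "A \<in> carrier_mat n n" and B: "B \<in> carrier_mat n 1" and P: "P \<in> carrier_mat n n"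
    and b: "mat_adjoint B * P * B = b \<cdot>\<^sub>m 1\<^sub>m 1" "b \<noteq> 0"
    and g: "g \<in> carrier_mat n 1" and zg: "z \<cdot>\<^sub>m g = A * g + B"
  shows "z \<cdot>\<^sub>m g = closed_loop A B P * g
    + (1 + (mat_adjoint B * P * A * g) $$ (0, 0) / b) \<cdot>\<^sub>m B"
proof -
  note dims = carrier_matD[OF A] carrier_matD[OF B] carrier_matD[OF P] carrier_matD[OF g]
  define V where "V = mat_adjoint B * P * A * g"
  have V: "V \<in> carrier_mat 1 1"
    using A B P g by (auto simp: V_def)
  have inv: "matinv (mat_adjoint B * P * B) = inverse b \<cdot>\<^sub>m 1\<^sub>m 1"
    unfolding b(1) using matinv_scalar[OF b(2)] .
  have "closed_loop A B P * g = A * g - inverse b \<cdot>\<^sub>m (B * V)"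
    unfolding closed_loop_def inv V_def by (simp add: mat_expand dims)
  also have "B * V = V $$ (0, 0) \<cdot>\<^sub>m B"
    using V by (intro scalar_mat_mult) (auto simp: dims)
  finally have "closed_loop A B P * g = A * g - inverse b \<cdot>\<^sub>m (V $$ (0, 0) \<cdot>\<^sub>m B)" .
  thus ?thesis
    unfolding zg V_def[symmetric] using A B g
    by (intro eq_matI) (auto simp: field_simps dims simp del: index_mult_mat(1))
qed

section \<open>The cascade of the two factors\<close>

text \<open>The first block is the state of \<open>(F, G\<^sub>\<Psi>)\<close> under unit input; its output \<open>Hx + D\<close>, scaled by \<open>s\<close>, is
  the input of the second. As \<open>g\<close> is the state of \<open>(Z, B)\<close> under the input \<open>d\<close>, the second state is
  \<open>g\<close> multiplied by the quotient \<open>w\<close> of the two inputs.\<close>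

lemma cascade_state:
  fixes B F G\<^sub>\<Psi> H D Z s x g :: "complex mat"
  assumes B: "B \<in> carrier_mat n 1" and Z: "Z \<in> carrier_mat n n"
    and ss: "state_space m F G\<^sub>\<Psi> H D"
    and s: "s \<in> carrier_mat 1 1"
    and x: "x \<in> carrier_mat m 1" "z \<cdot>\<^sub>m x = F * x + G\<^sub>\<Psi>"
    and g: "g \<in> carrier_mat n 1" and zg: "z \<cdot>\<^sub>m g = Z * g + d \<cdot>\<^sub>m B" and d: "d \<noteq> 0"
  defines "w \<equiv> s $$ (0, 0) * (H * x + D) $$ (0, 0) / d"
  shows "z \<cdot>\<^sub>m (x @\<^sub>r (w \<cdot>\<^sub>m g))
    = four_block_mat F (0\<^sub>m m n) (B * s * H) Z * (x @\<^sub>r (w \<cdot>\<^sub>m g)) + (G\<^sub>\<Psi> @\<^sub>r (B * s * D))"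
proof -
  have F: "F \<in> carrier_mat m m" "G\<^sub>\<Psi> \<in> carrier_mat m 1" "H \<in> carrier_mat 1 m" "D \<in> carrier_mat 1 1"
    using ss by (auto simp: state_space_def)
  note dims = carrier_matD[OF B] carrier_matD[OF Z] carrier_matD[OF s] carrier_matD[OF x(1)]
    carrier_matD[OF g] carrier_matD[OF F(1)] carrier_matD[OF F(2)] carrier_matD[OF F(3)] carrier_matD[OF F(4)]
  define y where "y = H * x + D"
  have y: "y \<in> carrier_mat 1 1" using F x by (simp add: y_def)
  have "B * s * H * x + B * s * D = (B * s) * y"
    by (simp add: y_def mult_assoc_dim distrib_left_dim dims)
  also have "\<dots> = y $$ (0, 0) \<cdot>\<^sub>m (B * s)"
    by (rule scalar_mat_mult[OF _ y]) (simp add: dims)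
  also have "\<dots> = y $$ (0, 0) \<cdot>\<^sub>m (s $$ (0, 0) \<cdot>\<^sub>m B)"
    by (subst scalar_mat_mult[OF _ s]) (simp_all add: dims)
  finally have By: "B * s * H * x + B * s * D = (s $$ (0, 0) * y $$ (0, 0)) \<cdot>\<^sub>m B"
    by (simp add: smult_smult_mat mult.commute)
  have "z \<cdot>\<^sub>m (w \<cdot>\<^sub>m g) = w \<cdot>\<^sub>m (Z * g + d \<cdot>\<^sub>m B)"
    unfolding zg[symmetric] by (simp add: smult_smult_mat mult.commute)
  also have "\<dots> = Z * (w \<cdot>\<^sub>m g) + (w * d) \<cdot>\<^sub>m B"
    using Z g B by (simp add: add_smult_distrib_left_mat[of _ n 1] smult_right_dim smult_smult_mat)
  also have "w * d = s $$ (0, 0) * y $$ (0, 0)"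
    using d by (simp add: w_def y_def)
  finally have bot: "z \<cdot>\<^sub>m (w \<cdot>\<^sub>m g) = Z * (w \<cdot>\<^sub>m g) + (B * s * H * x + B * s * D)"
    by (simp only: By)
  have "four_block_mat F (0\<^sub>m m n) (B * s * H) Z * (x @\<^sub>r (w \<cdot>\<^sub>m g))
      = (F * x) @\<^sub>r (B * s * H * x + Z * (w \<cdot>\<^sub>m g))"
    using F B s Z x g by (intro mult_append_rows) auto
  moreover have "z \<cdot>\<^sub>m (x @\<^sub>r (w \<cdot>\<^sub>m g)) = (z \<cdot>\<^sub>m x) @\<^sub>r (z \<cdot>\<^sub>m (w \<cdot>\<^sub>m g))"
    by (rule eq_matI) (auto simp: append_rows_def dims)
  moreover have "(F * x + G\<^sub>\<Psi>) @\<^sub>r (Z * (w \<cdot>\<^sub>m g) + (B * s * H * x + B * s * D))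
      = ((F * x) @\<^sub>r (B * s * H * x + Z * (w \<cdot>\<^sub>m g))) + (G\<^sub>\<Psi> @\<^sub>r (B * s * D))"
    by (rule eq_matI) (auto simp: append_rows_def dims simp del: index_mult_mat(1))
  ultimately show ?thesis
    by (simp only: x(2) bot)
qed

theorem mainTheorem2:
  fixes n m :: nat
    and A B \<Lambda> P F G\<^sub>\<Psi> H D Z F\<^sub>h G\<^sub>h \<Xi> :: "complex mat"
    and G :: "complex \<Rightarrow> complex mat"
    and \<Psi> :: "complex \<Rightarrow> real"
  assumes "A \<in> carrier_mat n n" and "B \<in> carrier_mat n 1"
    and "stable_mat A" and "eigenvalue A 0"
    and "reachable n A B"
    and G: "G = input_to_state A B"
    and "\<Psi> \<in> C_plus" and "circle_mean \<Psi> = 1"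
    and "\<exists>\<Phi>\<in>C_plus.
           circle_mean_mat n (\<lambda>z. complex_of_real (\<Phi> z) \<cdot>\<^sub>m (G z * mat_adjoint (G z))) = 1\<^sub>m n"
    and "\<forall>\<Phi>\<in>C_plus.
           circle_mean_mat n (\<lambda>z. complex_of_real (\<Phi> z) \<cdot>\<^sub>m (G z * mat_adjoint (G z))) = 1\<^sub>m n
           \<longrightarrow> circle_mean \<Phi> = 1"
    and "rational_on_circle \<Psi>"
    and "minimal_realization m F G\<^sub>\<Psi> H D"
    and "minimal_spectral_factor \<Psi> m F G\<^sub>\<Psi> H D"
    and "minimum_phase F G\<^sub>\<Psi> H D"
    and "\<Lambda> \<in> hermitian_mats n"
    and "\<forall>z\<in>unit_circle. 0 < (mat_adjoint (G z) * \<Lambda> * G z) $$ (0, 0)"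
    and "stabilizing_solution n A B \<Lambda> P"
    and Z: "Z = closed_loop A B P"
    and F\<^sub>h: "F\<^sub>h = four_block_mat F (0\<^sub>m m n) (B * inv_sqrt (mat_adjoint B * P * B) * H) Z"
    and G\<^sub>h: "G\<^sub>h = G\<^sub>\<Psi> @\<^sub>r (B * inv_sqrt (mat_adjoint B * P * B) * D)"
    and "\<Xi> \<in> carrier_mat (m + n) (m + n)"
    and "\<Xi> = F\<^sub>h * \<Xi> * mat_adjoint F\<^sub>h + G\<^sub>h * mat_adjoint G\<^sub>h"
  shows "circle_mean_mat n (\<lambda>z.
           (complex_of_real (\<Psi> z) / (mat_adjoint (G z) * \<Lambda> * G z) $$ (0, 0))
             \<cdot>\<^sub>m (G z * mat_adjoint (G z)))
         = append_cols (0\<^sub>m n m) (1\<^sub>m n) * \<Xi> * (0\<^sub>m m n @\<^sub>r 1\<^sub>m n)"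
proof -
  note A = assms(1) and B = assms(2) and stA = assms(3) and ss = assms(12) and sf = assms(13)
    and mp = assms(14) and L = assms(15) and pos = assms(16) and P = assms(17) and Xi = assms(21,22)
  let ?M = "mat_adjoint B * P * B"
  let ?s = "inv_sqrt ?M"
  define b where "b = ?M $$ (0, 0)"
  have Ph: "P \<in> hermitian_mats n" and are: "riccati_equation A B \<Lambda> P"
    and bpos: "0 < b" and stZ: "stable_mat Z"
    using P by (auto simp: stabilizing_solution_def Z b_def)
  have Pc: "P \<in> carrier_mat n n" and Lc: "\<Lambda> \<in> carrier_mat n n"
    using Ph L by (auto simp: hermitian_mats_def)
  have M: "?M = b \<cdot>\<^sub>m 1\<^sub>m 1"
    using A B Pc by (intro eq_matI) (auto simp: b_def simp del: index_mult_mat(1))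
  have bR: "b = of_real (Re b)" "Re b > 0" and b0: "b \<noteq> 0"
    using bpos by (auto simp: less_complex_def complex_eq_iff)
  have s: "?s \<in> carrier_mat 1 1" "?s $$ (0, 0) = of_real (1 / sqrt (Re b))"
    by (auto simp: inv_sqrt_def b_def)
  have Zc: "Z \<in> carrier_mat n n"
    using A B Pc by (auto simp: Z closed_loop_def)
  have ss': "state_space m F G\<^sub>\<Psi> H D"
    using ss by (simp add: minimal_realization_def)
  hence Fc: "F \<in> carrier_mat m m" "G\<^sub>\<Psi> \<in> carrier_mat m 1" "H \<in> carrier_mat 1 m" "D \<in> carrier_mat 1 1"
    by (auto simp: state_space_def)
  have stF: "stable_mat F"
    using mp by (simp add: minimum_phase_def)
  have Fh: "F\<^sub>h \<in> carrier_mat (m + n) (m + n)"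
    using Fc Zc unfolding F\<^sub>h by simp
  have BsH: "B * ?s * H \<in> carrier_mat n m"
    using B s Fc by simp
  have stFh: "stable_mat F\<^sub>h"
    unfolding F\<^sub>h by (rule stable_block_lower_triangular[OF Fc(1) BsH Zc stF stZ])
  have Gh: "G\<^sub>h \<in> carrier_mat (m + n) 1"
    using Fc B s unfolding G\<^sub>h by auto
  note ev = stable_not_eigenvalue[OF stA] stable_not_eigenvalue[OF stF] stable_not_eigenvalue[OF stFh]

  have key: "(complex_of_real (\<Psi> z) / (mat_adjoint (G z) * \<Lambda> * G z) $$ (0, 0)) * (G z $$ (i, 0) * cnj (G z $$ (j, 0)))
      = (resolvent F\<^sub>h z * G\<^sub>h) $$ (m + i, 0) * cnj ((resolvent F\<^sub>h z * G\<^sub>h) $$ (m + j, 0))"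
    if z: "z \<in> unit_circle" and ij: "i < n" "j < n" for z i j
  proof -
    define g where "g = G z"
    define x where "x = resolvent F z * G\<^sub>\<Psi>"
    define v where "v = (mat_adjoint B * P * A * g) $$ (0, 0)"
    define y where "y = (H * x + D) $$ (0, 0)"
    \<comment> \<open>\<open>w = W\<^sub>\<Psi> / W\<^sub>\<Lambda>\<close> with \<open>W\<^sub>\<Psi> = y\<close> and \<open>W\<^sub>\<Lambda> = b\<^sup>1\<^sup>/\<^sup>2 (1 + v/b)\<close>\<close>
    define w where "w = ?s $$ (0, 0) * y / (1 + v / b)"
    have z1: "cmod z = 1" using z by simp
    have g: "g = resolvent A z * B"
      by (simp add: g_def G input_to_state_def resolvent_def)
    note RA = resolvent_inverse(1)[OF A ev(1)[OF z]] and RF = resolvent_inverse(1)[OF Fc(1) ev(2)[OF z]]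
    have gc: "g \<in> carrier_mat n 1" and xc: "x \<in> carrier_mat m 1"
      using RA RF B Fc by (auto simp: g x_def)
    have zg: "z \<cdot>\<^sub>m g = A * g + B"
      unfolding g by (rule resolvent_state[OF A ev(1)[OF z] B])
    have zx: "z \<cdot>\<^sub>m x = F * x + G\<^sub>\<Psi>"
      unfolding x_def by (rule resolvent_state[OF Fc(1) ev(2)[OF z] Fc(2)])
    have fac: "b * (mat_adjoint g * \<Lambda> * g) $$ (0, 0) = (b + v) * cnj (b + v)"
      unfolding v_def using bR
      by (intro riccati_factorization[OF A B Ph Lc are M b0 _ gc z1 zg]) (metis Reals_of_real)
    have q0: "(mat_adjoint g * \<Lambda> * g) $$ (0, 0) \<noteq> 0"
      using bspec[OF pos z] unfolding g_def by (metis less_irrefl)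
    \<comment> \<open>positivity of \<open>g\<^sup>*\<Lambda>g\<close> keeps \<open>W\<^sub>\<Lambda>\<close> from vanishing on the circle\<close>
    hence bv: "b + v \<noteq> 0" using fac b0 by auto
    have Psi: "complex_of_real (\<Psi> z) = y * cnj y"
    proof -
      have "transfer F G\<^sub>\<Psi> H D z = y"
        using Fc RF by (simp add: transfer_def y_def x_def resolvent_def mult_assoc_dim)
      thus ?thesis
        using sf z ev(2)[OF z] by (auto simp: minimal_spectral_factor_def spectral_factor_def)
    qed
    have zgZ: "z \<cdot>\<^sub>m g = Z * g + (1 + v / b) \<cdot>\<^sub>m B"
      unfolding Z v_def by (rule closed_loop_shift[OF A B Pc M b0 gc zg])
    have "1 + v / b \<noteq> 0" using bv b0 by (simp add: field_simps)
    hence "z \<cdot>\<^sub>m (x @\<^sub>r (w \<cdot>\<^sub>m g)) = F\<^sub>h * (x @\<^sub>r (w \<cdot>\<^sub>m g)) + G\<^sub>h"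
      unfolding F\<^sub>h G\<^sub>h w_def y_def by (rule cascade_state[OF B Zc ss' s(1) xc zx gc zgZ])
    hence "x @\<^sub>r (w \<cdot>\<^sub>m g) = resolvent F\<^sub>h z * G\<^sub>h"
      using xc gc by (intro resolvent_unique[OF Fh ev(3)[OF z] _ Gh]) auto
    hence K: "(resolvent F\<^sub>h z * G\<^sub>h) $$ (m + l, 0) = w * g $$ (l, 0)" if "l < n" for l
      using that xc gc index_append_rows[of x m 1 "w \<cdot>\<^sub>m g" n "m + l" 0] by simp
    have "?s $$ (0, 0) * cnj (?s $$ (0, 0)) = 1 / b"
    proof -
      have "?s $$ (0, 0) * cnj (?s $$ (0, 0)) = of_real (1 / (sqrt (Re b) * sqrt (Re b)))"
        by (simp add: s(2) del: real_sqrt_mult_self)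
      also have "\<dots> = of_real (1 / Re b)"
        using bR(2) by simp
      finally show ?thesis by (subst bR(1)) simp
    qed
    moreover have "cnj b = b" using bR by (metis complex_cnj_complex_of_real)
    ultimately have "w * cnj w = (1 / b) * (y * cnj y) * (b * b) / ((b + v) * cnj (b + v))"
      using bv b0 by (simp add: w_def field_simps)
    also have "\<dots> = complex_of_real (\<Psi> z) / (mat_adjoint g * \<Lambda> * g) $$ (0, 0)"
      unfolding fac[symmetric] Psi using b0 q0 by (simp add: field_simps)
    finally have ww: "w * cnj w = complex_of_real (\<Psi> z) / (mat_adjoint g * \<Lambda> * g) $$ (0, 0)" .
    have "w * g $$ (i, 0) * cnj (w * g $$ (j, 0)) = w * cnj w * (g $$ (i, 0) * cnj (g $$ (j, 0)))"
      by (simp add: mult_ac)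
    thus ?thesis
      unfolding K[OF ij(1)] K[OF ij(2)] ww by (simp add: g_def)
  qed
  have mean: "circle_mean_mat (m + n) (\<lambda>z. resolvent F\<^sub>h z * (G\<^sub>h * mat_adjoint G\<^sub>h) * mat_adjoint (resolvent F\<^sub>h z)) = \<Xi>"
    using Gh by (intro circle_mean_gramian_eq[OF Fh stFh _ Xi]) auto
  show ?thesis
  proof (rule eq_matI)
    fix i j
    assume "i < dim_row (append_cols (0\<^sub>m n m) (1\<^sub>m n) * \<Xi> * (0\<^sub>m m n @\<^sub>r 1\<^sub>m n))"
      "j < dim_col (append_cols (0\<^sub>m n m) (1\<^sub>m n) * \<Xi> * (0\<^sub>m m n @\<^sub>r 1\<^sub>m n))"
    hence ij: "i < n" "j < n" by (auto simp: append_cols_def append_rows_def)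
    have pw: "((complex_of_real (\<Psi> z) / (mat_adjoint (G z) * \<Lambda> * G z) $$ (0, 0)) \<cdot>\<^sub>m (G z * mat_adjoint (G z))) $$ (i, j)
        = (resolvent F\<^sub>h z * (G\<^sub>h * mat_adjoint G\<^sub>h) * mat_adjoint (resolvent F\<^sub>h z)) $$ (m + i, m + j)"
      if z: "z \<in> unit_circle" for z
    proof -
      have Gz: "G z \<in> carrier_mat n 1"
        using resolvent_inverse(1)[OF A ev(1)[OF z]] A B
        by (simp add: G input_to_state_def resolvent_def)
      have R: "resolvent F\<^sub>h z \<in> carrier_mat (m + n) (m + n)"
        by (rule resolvent_inverse(1)[OF Fh ev(3)[OF z]])
      define K where "K = resolvent F\<^sub>h z * G\<^sub>h"
      have K: "K \<in> carrier_mat (m + n) 1" using R Gh by (simp add: K_def)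
      have "resolvent F\<^sub>h z * (G\<^sub>h * mat_adjoint G\<^sub>h) * mat_adjoint (resolvent F\<^sub>h z) = K * mat_adjoint K"
        using R Gh by (simp add: K_def adjoint_mult mult_assoc_dim)
      moreover have "(K * mat_adjoint K) $$ (m + i, m + j) = K $$ (m + i, 0) * cnj (K $$ (m + j, 0))"
        using K ij by (simp add: scalar_prod_def)
      moreover have "(G z * mat_adjoint (G z)) $$ (i, j) = G z $$ (i, 0) * cnj (G z $$ (j, 0))"
        using Gz ij by (simp add: scalar_prod_def)
      ultimately show ?thesis
        using key[OF z ij] Gz ij by (simp add: K_def[symmetric] del: index_mult_mat(1))
    qed
    have "circle_mean (\<lambda>z. ((complex_of_real (\<Psi> z) / (mat_adjoint (G z) * \<Lambda> * G z) $$ (0, 0)) \<cdot>\<^sub>m (G z * mat_adjoint (G z))) $$ (i, j))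
        = circle_mean (\<lambda>z. (resolvent F\<^sub>h z * (G\<^sub>h * mat_adjoint G\<^sub>h) * mat_adjoint (resolvent F\<^sub>h z)) $$ (m + i, m + j))"
      by (rule circle_mean_cong[OF pw])
    also have "\<dots> = \<Xi> $$ (m + i, m + j)"
      using ij unfolding mean[symmetric] by (simp add: circle_mean_mat_def)
    finally have "circle_mean (\<lambda>z. ((complex_of_real (\<Psi> z) / (mat_adjoint (G z) * \<Lambda> * G z) $$ (0, 0)) \<cdot>\<^sub>m (G z * mat_adjoint (G z))) $$ (i, j))
        = \<Xi> $$ (m + i, m + j)" .
    thus "circle_mean_mat n (\<lambda>z. (complex_of_real (\<Psi> z) / (mat_adjoint (G z) * \<Lambda> * G z) $$ (0, 0)) \<cdot>\<^sub>m (G z * mat_adjoint (G z))) $$ (i, j)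
        = (append_cols (0\<^sub>m n m) (1\<^sub>m n) * \<Xi> * (0\<^sub>m m n @\<^sub>r 1\<^sub>m n)) $$ (i, j)"
      using ij bottom_right_block[OF Xi(1) ij] by (simp add: circle_mean_mat_def del: index_mult_mat(1))
  qed (auto simp: append_cols_def append_rows_def)
qed

end
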